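(* Let $m\ge1$ and $k\ge 1$ be integers, $\lambda,\mu\in\mathbb{R}$ and $\delta=\mu-\lambda$. The short exact sequence of $s\ell_{m+1}$-modules $$0\to\mathcal{D}^{k-1}_{\lambda\mu}(\mathbb{R}^m)\xrightarrow{\,i\,}\mathcal{D}^{k}_{\lambda\mu}(\mathbb{R}^m)\xrightarrow{\,\sigma\,}\mathcal{S}^k_\delta(\mathbb{R}^m)\to0$$ is split (as a sequence of $s\ell_{m+1}$-modules) if and only if $$\delta\notin\left\{\frac{m+k}{m+1},\frac{m+k+1}{m+1},\dots,\frac{m+2k-1}{m+1}\right\}$$ or $$\delta=\frac{m+2k-n}{m+1}\quad\text{and}\quad\lambda=\frac{i-k}{m+1}$$ for some $n\in\{1,\dots,k\}$ and some $i\in\{1,\dots,n\}$.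
   Context: $s\ell_{m+1}$ denotes the Lie subalgebra of the Lie algebra $Vect(\mathbb{R}^m)$ of smooth vector fields on $\mathbb{R}^m$ spanned by $\partial_i$, $x^j\partial_i$ and $x^jE$ ($1\le i,j\le m$), where $E=\sum_i x^i\partial_i$; it is isomorphic to $s\ell(m+1,\mathbb{R})$. The space of scalar $\lambda$-densities on $\mathbb{R}^m$ is identified with $C_\infty(\mathbb{R}^m)$ with Lie derivative $L^\lambda_Xf=X.f+\lambda\,\mathrm{tr}(DX)f$, where $X.f=\sum_iX^i\partial_if$ and $DX=(\partial_jX^i)$. $\mathcal{D}^k_{\lambda\mu}(\mathbb{R}^m)$ is the space of linear differential operators of order $\le k$ from $\lambda$-densities to $\mu$-densities, with $X$ acting by $A\mapsto L^\mu_X\circ A-A\circ L^\lambda_X$. $\mathcal{S}^k_\delta(\mathbb{R}^m)$ is the space of smooth symmetric $k$-contravariant tensor fields on $\mathbb{R}^m$ with values in the $\delta$-densities. It is identified with $C_\infty(\mathbb{R}^m,\vee^k\mathbb{R}^m)$, with Lie derivative $L_XP=X.P-\rho(DX)P+\delta\,\mathrm{tr}(DX)P$, where $\rho$ is the natural representation of $g\ell(m,\mathbb{R})$ on $\vee^k\mathbb{R}^m$. $i$ is the inclusion and $\sigma$ is the (principal) symbol map: if $A=\sum_{|\alpha|\le k}a_\alpha\partial^\alpha$, then $\sigma(A)(\xi)=\sum_{|\alpha|=k}a_\alpha\xi^\alpha$, viewing elements of $\vee^k\mathbb{R}^m$ as homogeneous polynomials of degree $k$ in $\xi\in\mathbb{R}^{m*}$.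 *)

theory Defs
  imports "HOL-Analysis.Analysis"
begin

definition partial :: "'m \<Rightarrow> (real^'m \<Rightarrow> real) \<Rightarrow> (real^'m \<Rightarrow> real)"
  where "partial i f = (\<lambda>x. frechet_derivative f (at x) (axis i 1))"

definition Cinf :: "(real^'m \<Rightarrow> real) set"
  where "Cinf = {f. \<forall>is x. foldr partial is f differentiable (at x)}"

definition mi_abs :: "('m::finite \<Rightarrow> nat) \<Rightarrow> nat"
  where "mi_abs \<alpha> = (\<Sum>i\<in>UNIV. \<alpha> i)"

definition mi_power :: "real^'m \<Rightarrow> ('m \<Rightarrow> nat) \<Rightarrow> real"
  where "mi_power \<xi> \<alpha> = (\<Prod>i\<in>UNIV. (\<xi> $ i) ^ \<alpha> i)"

text \<open>The index type carries no order, so the partial derivatives are applied in some arbitrary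
  order in which \<open>i\<close> occurs \<open>\<alpha> i\<close> times; on smooth functions the order is irrelevant.\<close>

definition mi_partial :: "('m::finite \<Rightarrow> nat) \<Rightarrow> (real^'m \<Rightarrow> real) \<Rightarrow> (real^'m \<Rightarrow> real)"
  where "mi_partial \<alpha> f = foldr partial (SOME is. \<forall>i. count_list is i = \<alpha> i) f"

lemma ex_list_of_multi_index:
  fixes \<alpha> :: "'m::finite \<Rightarrow> nat"
  shows "\<exists>is. \<forall>i. count_list is i = \<alpha> i"
proof -
  have "\<exists>is. \<forall>i. count_list is i = (if i \<in> S then \<alpha> i else 0)" if "finite S" for S :: "'m set"
    using that
  proof (induction S rule: finite_induct)
    case empty
    show ?case by (rule exI[of _ "[]"]) simp
  next
    case (insert j S)
    then obtain js where js: "\<And>i. count_list js i = (if i \<in> S then \<alpha> i else 0)" by blast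
    have rep: "count_list (replicate n j) i = (if i = j then n else 0)" for n i
      by (induction n) auto
    show ?case
      using insert.hyps by (intro exI[of _ "replicate (\<alpha> j) j @ js"]) (auto simp: js rep)
  qed
  from this[of UNIV] show ?thesis by simp
qed

lemma finite_mi_abs_le: "finite {\<alpha> :: 'm::finite \<Rightarrow> nat. mi_abs \<alpha> \<le> k}"
proof (rule finite_subset)
  have "\<alpha> i \<le> k" if "mi_abs \<alpha> \<le> k" for \<alpha> :: "'m \<Rightarrow> nat" and i
    using that member_le_sum[of i UNIV \<alpha>] by (auto simp: mi_abs_def)
  then show "{\<alpha> :: 'm \<Rightarrow> nat. mi_abs \<alpha> \<le> k} \<subseteq> PiE UNIV (\<lambda>_. {..k})" by auto
  show "finite (PiE (UNIV :: 'm set) (\<lambda>_. {..k}))" by (intro finite_PiE) auto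
qed

text \<open>The vector field \<open>\<partial>\<^sub>i\<close> is the constant map \<open>axis i 1\<close> and the Euler field is the identity map.\<close>

definition sl_proj :: "(real^'m \<Rightarrow> real^'m) set"
  where "sl_proj = {X. \<exists>a b c. X = (\<lambda>x.
      (\<Sum>i\<in>UNIV. a i *\<^sub>R axis i 1)
    + (\<Sum>i\<in>UNIV. \<Sum>j\<in>UNIV. b i j *\<^sub>R (x $ j *\<^sub>R axis i 1))
    + (\<Sum>j\<in>UNIV. c j *\<^sub>R (x $ j *\<^sub>R x)))}"

record ('g, 'v) module_data =
  mcarrier :: "'v set"
  mzero :: 'v
  madd :: "'v \<Rightarrow> 'v \<Rightarrow> 'v"
  mscale :: "real \<Rightarrow> 'v \<Rightarrow> 'v"
  mact :: "'g \<Rightarrow> 'v \<Rightarrow> 'v"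

definition module_hom_on ::
    "'g set \<Rightarrow> ('g, 'v) module_data \<Rightarrow> ('g, 'w) module_data \<Rightarrow> ('v \<Rightarrow> 'w) \<Rightarrow> bool"
  where "module_hom_on G M N h \<longleftrightarrow>
      h \<in> mcarrier M \<rightarrow> mcarrier N
    \<and> (\<forall>u\<in>mcarrier M. \<forall>v\<in>mcarrier M. h (madd M u v) = madd N (h u) (h v))
    \<and> (\<forall>c. \<forall>v\<in>mcarrier M. h (mscale M c v) = mscale N c (h v))
    \<and> (\<forall>X\<in>G. \<forall>v\<in>mcarrier M. h (mact M X v) = mact N X (h v))"

definition short_exact ::
    "'g set \<Rightarrow> ('g, 'u) module_data \<Rightarrow> ('u \<Rightarrow> 'v) \<Rightarrow> ('g, 'v) module_data \<Rightarrow> ('v \<Rightarrow> 'w)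
      \<Rightarrow> ('g, 'w) module_data \<Rightarrow> bool"
  where "short_exact G L i M p N \<longleftrightarrow>
      module_hom_on G L M i \<and> module_hom_on G M N p
    \<and> inj_on i (mcarrier L)
    \<and> i ` mcarrier L = {v \<in> mcarrier M. p v = mzero N}
    \<and> p ` mcarrier M = mcarrier N"

definition split_short_exact ::
    "'g set \<Rightarrow> ('g, 'u) module_data \<Rightarrow> ('u \<Rightarrow> 'v) \<Rightarrow> ('g, 'v) module_data \<Rightarrow> ('v \<Rightarrow> 'w)
      \<Rightarrow> ('g, 'w) module_data \<Rightarrow> bool"
  where "split_short_exact G L i M p N \<longleftrightarrow>
      short_exact G L i M p N
    \<and> (\<exists>s. module_hom_on G N M s \<and> (\<forall>w\<in>mcarrier N. p (s w) = w))"

text \<open>\<open>jacobian X (at x)\<close> is the matrix \<open>DX\<close> with entry \<open>\<partial>\<^sub>j X\<^sup>i\<close> in row \<open>i\<close> and column \<open>j\<close>.\<close>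

definition lie_dens ::
    "real \<Rightarrow> (real^'m \<Rightarrow> real^'m) \<Rightarrow> (real^'m \<Rightarrow> real) \<Rightarrow> (real^'m \<Rightarrow> real)"
  where "lie_dens l X f = (\<lambda>x.
    (\<Sum>i\<in>UNIV. X x $ i * partial i f x) + l * trace (jacobian X (at x)) * f x)"

text \<open>Operators are maps on \<^term>\<open>Cinf\<close>, made extensional (undefined elsewhere) so that equality of
  operators is equality of HOL functions.\<close>

definition diff_op ::
    "nat \<Rightarrow> (('m \<Rightarrow> nat) \<Rightarrow> real^'m \<Rightarrow> real) \<Rightarrow> (real^'m \<Rightarrow> real) \<Rightarrow> (real^'m \<Rightarrow> real)"
  where "diff_op k a = (\<lambda>f\<in>Cinf. \<lambda>x. \<Sum>\<alpha> | mi_abs \<alpha> \<le> k. a \<alpha> x * mi_partial \<alpha> f x)"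

definition diff_op_module :: "nat \<Rightarrow> real \<Rightarrow> real \<Rightarrow>
    (real^'m \<Rightarrow> real^'m, (real^'m \<Rightarrow> real) \<Rightarrow> (real^'m \<Rightarrow> real)) module_data"
  where "diff_op_module k l u = \<lparr>
    mcarrier = {diff_op k a | a. \<forall>\<alpha>. a \<alpha> \<in> Cinf},
    mzero = (\<lambda>f\<in>Cinf. \<lambda>x. 0),
    madd = (\<lambda>A B. \<lambda>f\<in>Cinf. \<lambda>x. A f x + B f x),
    mscale = (\<lambda>c A. \<lambda>f\<in>Cinf. \<lambda>x. c * A f x),
    mact = (\<lambda>X A. \<lambda>f\<in>Cinf. \<lambda>x. lie_dens u X (A f) x - A (lie_dens l X f) x) \<rparr>"

text \<open>Elements of \<open>\<or>\<^sup>k \<real>\<^sup>m\<close> are homogeneous polynomial functions of a covector \<open>\<xi>\<close>, covectors being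
  identified with vectors by the dual basis, so that the pairing of \<open>\<xi>\<close> and \<open>v\<close> is \<open>\<xi> \<bullet> v\<close> and
  \<open>v\<^sub>1 \<or> \<dots> \<or> v\<^sub>k\<close> is the polynomial \<open>\<Prod>\<^sub>i \<xi> \<bullet> v\<^sub>i\<close>. The group acts by \<open>(g p)(\<xi>) = p (g\<^sup>T \<xi>)\<close>, so the
  Lie algebra acts by the formula below; \<open>gl_act_decomposable\<close> confirms that this is the usual
  derivation action on symmetric products.\<close>

definition gl_act :: "real^'m^'m \<Rightarrow> (real^'m \<Rightarrow> real) \<Rightarrow> (real^'m \<Rightarrow> real)"
  where "gl_act B p = (\<lambda>\<xi>. frechet_derivative p (at \<xi>) (transpose B *v \<xi>))"

lemma gl_act_decomposable:
  fixes v :: "nat \<Rightarrow> real^'m"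
  shows "gl_act B (\<lambda>\<xi>. \<Prod>i<k. \<xi> \<bullet> v i) =
    (\<lambda>\<xi>. \<Sum>j<k. \<Prod>i<k. \<xi> \<bullet> (if i = j then B *v v i else v i))"
proof
  fix \<xi> :: "real^'m"
  have D: "((\<lambda>\<xi>. \<Prod>i<k. \<xi> \<bullet> v i) has_derivative
      (\<lambda>h. \<Sum>j<k. (h \<bullet> v j) * (\<Prod>i\<in>{..<k} - {j}. \<xi> \<bullet> v i))) (at \<xi>)"
    by (rule has_derivative_prod) (auto intro!: derivative_eq_intros)
  have "(transpose B *v \<xi>) \<bullet> v j * (\<Prod>i\<in>{..<k} - {j}. \<xi> \<bullet> v i)
      = (\<Prod>i<k. \<xi> \<bullet> (if i = j then B *v v i else v i))" if "j < k" for j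
  proof -
    have "(transpose B *v \<xi>) \<bullet> v j = \<xi> \<bullet> (B *v v j)"
      by (metis dot_lmul_matrix inner_commute transpose_matrix_vector)
    moreover have "(\<Prod>i\<in>{..<k} - {j}. \<xi> \<bullet> v i)
        = (\<Prod>i\<in>{..<k} - {j}. \<xi> \<bullet> (if i = j then B *v v i else v i))"
      by (rule prod.cong) auto
    ultimately show ?thesis
      using that by (subst prod.remove[of _ j]) auto
  qed
  then show "gl_act B (\<lambda>\<xi>. \<Prod>i<k. \<xi> \<bullet> v i) \<xi> =
      (\<Sum>j<k. \<Prod>i<k. \<xi> \<bullet> (if i = j then B *v v i else v i))"
    unfolding gl_act_def frechet_derivative_at[OF D, symmetric] by (intro sum.cong) auto
qed

definition lie_symb :: "real \<Rightarrow> (real^'m \<Rightarrow> real^'m)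
    \<Rightarrow> (real^'m \<Rightarrow> real^'m \<Rightarrow> real) \<Rightarrow> (real^'m \<Rightarrow> real^'m \<Rightarrow> real)"
  where "lie_symb d X P = (\<lambda>x \<xi>.
      (\<Sum>i\<in>UNIV. X x $ i * partial i (\<lambda>y. P y \<xi>) x)
    - gl_act (jacobian X (at x)) (P x) \<xi>
    + d * trace (jacobian X (at x)) * P x \<xi>)"

definition symb_of ::
    "nat \<Rightarrow> (('m \<Rightarrow> nat) \<Rightarrow> real^'m \<Rightarrow> real) \<Rightarrow> (real^'m \<Rightarrow> real^'m \<Rightarrow> real)"
  where "symb_of k a = (\<lambda>x \<xi>. \<Sum>\<alpha> | mi_abs \<alpha> = k. a \<alpha> x * mi_power \<xi> \<alpha>)"

definition symbol_module :: "nat \<Rightarrow> real \<Rightarrow>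
    (real^'m \<Rightarrow> real^'m, real^'m \<Rightarrow> real^'m \<Rightarrow> real) module_data"
  where "symbol_module k d = \<lparr>
    mcarrier = {symb_of k a | a. \<forall>\<alpha>. a \<alpha> \<in> Cinf},
    mzero = (\<lambda>x \<xi>. 0),
    madd = (\<lambda>P Q x \<xi>. P x \<xi> + Q x \<xi>),
    mscale = (\<lambda>c P x \<xi>. c * P x \<xi>),
    mact = lie_symb d \<rparr>"

text \<open>Well defined because the coefficients of a differential operator are determined by it.\<close>

definition principal_symbol ::
    "nat \<Rightarrow> ((real^'m \<Rightarrow> real) \<Rightarrow> (real^'m \<Rightarrow> real)) \<Rightarrow> (real^'m \<Rightarrow> real^'m \<Rightarrow> real)"
  where "principal_symbol k A =
    (THE P. \<exists>a. (\<forall>\<alpha>. a \<alpha> \<in> Cinf) \<and> A = diff_op k a \<and> P = symb_of k a)"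

end

(* Write an operator as its coefficient family, so that affine fields act on operators as they act
   on symbols; a quadratic field c(x) E acts on the degree r component with the extra term
   -(r - 1 + lam (m + 1)) c.d_xi, of degree r - 1. The divergence Div = sum_i d_{x_i} d_{xi_i}
   commutes with the affine action, and its j-th power fails to commute with c(x) E on degree k by
   j (delta (m + 1) - (m + 2 k - j)) (c.d_xi) Div^{j-1}. Hence sum_j w_j Div^j is an equivariant section
   as soon as
     w_j j (delta (m + 1) - (m + 2 k - j)) = - (k - j + lam (m + 1)) w_{j-1},   w_0 = 1,
   and this is solvable precisely under the stated condition.
   Conversely let s be any equivariant section, not assumed local. Put b_j equal to the value at the origin
   of s(x_1^j xi_1^k) applied to x_1^(k-j). Then
     L_{x_1 E}(x_1^(j-1) xi_1^k) = (delta (m + 1) - (m + 2 k - j)) x_1^j xi_1^k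
        + (1/j) sum_{a > 1} L_{x_1 d_a} L_{x_a d_1} (x_1^j xi_1^k),
   and the sum contributes nothing to the evaluation, because x_1 d_a kills x_1^(k-j) and vanishes at 0.
   So the b_j obey the same recursion up to nonzero factors, with b_0 = k!. *)
theory Submission
  imports Defs
begin

text \<open>Where the condition comes from: for given \<delta> the factor
  \<open>\<delta> (m + 1) - (m + 2 k - j)\<close> vanishes for at most one index j = n. There w_n is
  free but the right-hand side has to vanish, and w_{n-1} is, up to nonzero factors, the product of
  the numbers \<open>k - i + lam (m + 1)\<close> with i < n. So one such number with i \<le> n must
  be zero, which is the condition on lam. The same product decides the converse: if no factor
  vanishes, b_{n-1} is nonzero and the recursion at n is contradictory. The obstacle in the converse
  is that the coefficients of s(P) need not be local expressions in P, so they cannot be compared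
  with derivatives of P. Only numbers are compared: at the origin the fields used vanish together
  with their divergence, the Lie derivative of the target densities drops out, and just the action
  on the operand is left. Affine fields behave alike on operators and symbols because moving a field
  component through an operator costs \<xi>-derivatives, and those of second order are paired with
  second derivatives of the field.\<close>

section \<open>Smooth functions\<close>

lemma partial_eqI: "(f has_derivative D) (at x) \<Longrightarrow> partial i f x = D (axis i 1)"
  unfolding partial_def by (metis frechet_derivative_at)

lemma frechet_derivative_eq_sum_partial:
  fixes f :: "real^'m \<Rightarrow> real"
  assumes "f differentiable (at x)"
  shows "frechet_derivative f (at x) v = (\<Sum>i\<in>UNIV. v $ i * partial i f x)"
proof -
  let ?D = "frechet_derivative f (at x)"
  have lin: "linear ?D"
    using assms by (rule linear_frechet_derivative)
  have "?D v = ?D (\<Sum>i\<in>UNIV. v $ i *\<^sub>R axis i 1)"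
    using basis_expansion[of v] by (simp add: scalar_mult_eq_scaleR)
  also have "\<dots> = (\<Sum>i\<in>UNIV. v $ i * ?D (axis i 1))"
    using lin by (simp add: linear_sum linear_scale)
  finally show ?thesis
    by (simp add: partial_def)
qed

lemma partial_add:
  assumes "f differentiable (at x)" "g differentiable (at x)"
  shows "partial i (\<lambda>y. f y + g y) x = partial i f x + partial i g x"
proof -
  have "((\<lambda>y. f y + g y) has_derivative
      (\<lambda>h. frechet_derivative f (at x) h + frechet_derivative g (at x) h)) (at x)"
    using assms by (intro has_derivative_add) (simp_all add: frechet_derivative_works[symmetric])
  from partial_eqI[OF this] show ?thesis by (simp add: partial_def)
qed

lemma partial_mult:
  assumes "f differentiable (at x)" "g differentiable (at x)"
  shows "partial i (\<lambda>y. f y * g y) x = partial i f x * g x + f x * partial i g x"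
proof -
  have "((\<lambda>y. f y * g y) has_derivative
      (\<lambda>h. f x * frechet_derivative g (at x) h + frechet_derivative f (at x) h * g x)) (at x)"
    using assms by (intro has_derivative_mult) (simp_all add: frechet_derivative_works[symmetric])
  from partial_eqI[OF this] show ?thesis by (simp add: partial_def)
qed

lemma partial_const [simp]: "partial i (\<lambda>y. c) x = 0"
  by (simp add: partial_def)

lemma partial_const_fun [simp]: "partial i (\<lambda>y. c) = (\<lambda>y. 0)"
  by (rule ext) simp

lemma differentiable_nth [simp]: "(\<lambda>y::real^'m. y $ j) differentiable (at x)"
  by (rule bounded_linear_imp_differentiable) (rule bounded_linear_vec_nth)

lemma partial_nth [simp]: "partial i (\<lambda>y. y $ j) (x::real^'m) = (if i = j then 1 else 0)"
  by (subst partial_eqI[OF bounded_linear_imp_has_derivative[OF bounded_linear_vec_nth]])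
    (auto simp: axis_def)

lemma partial_nth_fun: "partial i (\<lambda>y. y $ j) = (\<lambda>x::real^'m. if i = j then 1 else 0)"
  by (rule ext) simp

lemma partial_cmult:
  assumes "f differentiable (at x)"
  shows "partial i (\<lambda>y. c * f y) x = c * partial i f x"
  using partial_mult[OF _ assms, of "\<lambda>_. c" i] by simp

lemma partial_sum:
  assumes "\<And>j. j \<in> I \<Longrightarrow> f j differentiable (at x)"
  shows "partial i (\<lambda>y. \<Sum>j\<in>I. f j y) x = (\<Sum>j\<in>I. partial i (f j) x)"
  using assms by (induction I rule: infinite_finite_induct) (auto simp: partial_add)

lemma partial_power:
  assumes "f differentiable (at x)"
  shows "partial i (\<lambda>y. f y ^ n) x = real n * f x ^ (n - 1) * partial i f x"
proof -
  have "((\<lambda>y. f y ^ n) has_derivative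
      (\<lambda>h. of_nat n * frechet_derivative f (at x) h * f x ^ (n - 1))) (at x)"
    using assms by (intro has_derivative_power) (simp add: frechet_derivative_works[symmetric])
  from partial_eqI[OF this] show ?thesis by (simp add: partial_def)
qed

lemma Cinf_differentiable: "f \<in> Cinf \<Longrightarrow> f differentiable (at x)"
  unfolding Cinf_def by (drule CollectD, drule spec[of _ "[]"]) simp

lemma Cinf_partial: "f \<in> Cinf \<Longrightarrow> partial i f \<in> Cinf"
  unfolding Cinf_def
proof (intro CollectI allI)
  fix "is" x
  assume "f \<in> {f. \<forall>is x. foldr partial is f differentiable (at x)}"
  then have "foldr partial (is @ [i]) f differentiable (at x)" by blast
  then show "foldr partial is (partial i f) differentiable (at x)" by simp
qed

text \<open>\<open>Cinf\<close> is the largest set of differentiable functions stable under all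
  \<open>partial i\<close>, so every such stable set lies inside it. This replaces an induction over
  lists of derivatives for each closure property.\<close>

lemma Cinf_coinduct:
  assumes "f \<in> S"
    and diff: "\<And>g x. g \<in> S \<Longrightarrow> g differentiable (at x)"
    and closed: "\<And>g i. g \<in> S \<Longrightarrow> partial i g \<in> S"
  shows "f \<in> Cinf"
proof -
  have "foldr partial is f \<in> S" for "is"
    using \<open>f \<in> S\<close> closed by (induction "is") auto
  then show ?thesis
    using diff by (auto simp: Cinf_def)
qed

text \<open>Derivatives of a product are sums of products, so products alone are not stable under
  \<open>partial\<close>. The algebra generated by \<open>Cinf\<close>, constants and coordinates is
  stable, and by \<open>Cinf_coinduct\<close> it is no larger than \<open>Cinf\<close>; this gives
  the closure rules at once.\<close>

inductive_set smooth_closure :: "(real^'m \<Rightarrow> real) set" where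
  base: "f \<in> Cinf \<Longrightarrow> f \<in> smooth_closure"
| const: "(\<lambda>_. c) \<in> smooth_closure"
| nth: "(\<lambda>x. x $ i) \<in> smooth_closure"
| add: "f \<in> smooth_closure \<Longrightarrow> g \<in> smooth_closure \<Longrightarrow> (\<lambda>x. f x + g x) \<in> smooth_closure"
| mult: "f \<in> smooth_closure \<Longrightarrow> g \<in> smooth_closure \<Longrightarrow> (\<lambda>x. f x * g x) \<in> smooth_closure"

lemma smooth_closure_diff:
  "f \<in> smooth_closure \<Longrightarrow> (\<forall>x. f differentiable (at x)) \<and> partial i f \<in> smooth_closure"
proof (induction rule: smooth_closure.induct)
  case (base f)
  then show ?case by (auto intro: smooth_closure.intros Cinf_differentiable Cinf_partial)
next
  case (const c)
  show ?case by (auto intro: smooth_closure.intros)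
next
  case (nth j)
  show ?case by (auto simp: partial_nth_fun intro: smooth_closure.intros)
next
  case (add f g)
  then have "partial i (\<lambda>x. f x + g x) = (\<lambda>x. partial i f x + partial i g x)"
    by (auto simp: partial_add)
  with add show ?case by (auto intro: smooth_closure.intros)
next
  case (mult f g)
  then have "partial i (\<lambda>x. f x * g x) = (\<lambda>x. partial i f x * g x + f x * partial i g x)"
    by (auto simp: partial_mult)
  with mult show ?case by (simp add: smooth_closure.add smooth_closure.mult)
qed

lemma smooth_closure_subset: "f \<in> smooth_closure \<Longrightarrow> f \<in> Cinf"
  by (rule Cinf_coinduct[of _ smooth_closure]) (auto dest: smooth_closure_diff)

lemma Cinf_const [intro, simp]: "(\<lambda>_. c) \<in> Cinf"
  by (rule smooth_closure_subset[OF smooth_closure.const])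

lemma Cinf_nth [intro, simp]: "(\<lambda>x::real^'m. x $ i) \<in> Cinf"
  by (rule smooth_closure_subset[OF smooth_closure.nth])

lemma Cinf_add [intro]: "f \<in> Cinf \<Longrightarrow> g \<in> Cinf \<Longrightarrow> (\<lambda>x. f x + g x) \<in> Cinf"
  by (rule smooth_closure_subset) (intro smooth_closure.add smooth_closure.base)

lemma Cinf_mult [intro]: "f \<in> Cinf \<Longrightarrow> g \<in> Cinf \<Longrightarrow> (\<lambda>x. f x * g x) \<in> Cinf"
  by (rule smooth_closure_subset) (intro smooth_closure.mult smooth_closure.base)

lemma Cinf_minus [intro]: "f \<in> Cinf \<Longrightarrow> (\<lambda>x. - f x) \<in> Cinf"
  using Cinf_mult[of "\<lambda>_. -1" f] by simp

lemma Cinf_diff [intro]: "f \<in> Cinf \<Longrightarrow> g \<in> Cinf \<Longrightarrow> (\<lambda>x. f x - g x) \<in> Cinf"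
  using Cinf_add[OF _ Cinf_minus, of f g] by simp

lemma Cinf_sum [intro]: "(\<And>i. i \<in> I \<Longrightarrow> f i \<in> Cinf) \<Longrightarrow> (\<lambda>x. \<Sum>i\<in>I. f i x) \<in> Cinf"
  by (induction I rule: infinite_finite_induct) auto

lemma Cinf_prod [intro]: "(\<And>i. i \<in> I \<Longrightarrow> f i \<in> Cinf) \<Longrightarrow> (\<lambda>x. \<Prod>i\<in>I. f i x) \<in> Cinf"
  by (induction I rule: infinite_finite_induct) auto

lemma Cinf_power [intro]: "f \<in> Cinf \<Longrightarrow> (\<lambda>x. f x ^ n) \<in> Cinf"
  by (induction n) auto

section \<open>Symmetry of mixed partial derivatives\<close>

lemma has_field_derivative_along_axis:
  fixes f :: "real^'m \<Rightarrow> real"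
  assumes "f \<in> Cinf"
  shows "((\<lambda>t. f (y + t *\<^sub>R axis i 1)) has_field_derivative partial i f (y + t *\<^sub>R axis i 1)) (at t)"
proof -
  let ?l = "\<lambda>t. y + t *\<^sub>R axis i 1"
  have "(f has_derivative frechet_derivative f (at (?l t))) (at (?l t))"
    using Cinf_differentiable[OF assms, of "?l t"] unfolding frechet_derivative_works .
  moreover have "(?l has_derivative (\<lambda>h. h *\<^sub>R axis i 1)) (at t)"
    by (auto intro!: derivative_eq_intros)
  ultimately have "((\<lambda>t. f (?l t)) has_derivative
      (\<lambda>h. frechet_derivative f (at (?l t)) (h *\<^sub>R axis i 1))) (at t)"
    using has_derivative_compose[of ?l "\<lambda>h. h *\<^sub>R axis i 1" t UNIV f] by blast
  moreover have "frechet_derivative f (at (y + t *\<^sub>R axis i 1)) (h *\<^sub>R axis i 1)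
      = partial i f (y + t *\<^sub>R axis i 1) * h" for h
    using linear_frechet_derivative[OF Cinf_differentiable[OF assms, of "?l t"]]
    by (simp add: partial_def linear_scale)
  ultimately show ?thesis
    by (simp add: has_field_derivative_def)
qed

text \<open>The mean value theorem is applied twice: in direction i to a difference in direction j,
  then in direction j to the partial derivative so obtained. The second difference is unchanged when
  i and j are swapped, which makes the mixed derivatives comparable.\<close>

lemma second_difference_MVT:
  fixes f :: "real^'m \<Rightarrow> real"
  assumes f: "f \<in> Cinf" and h: "h > 0"
  shows "\<exists>p. dist p x < 2 * h \<and>
    f (x + h *\<^sub>R axis i 1 + h *\<^sub>R axis j 1) - f (x + h *\<^sub>R axis i 1) - f (x + h *\<^sub>R axis j 1) + f x
      = h * h * partial j (partial i f) p"
proof -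
  define g where "g t = f ((x + h *\<^sub>R axis j 1) + t *\<^sub>R axis i 1) - f (x + t *\<^sub>R axis i 1)" for t
  define g' where "g' t = partial i f ((x + h *\<^sub>R axis j 1) + t *\<^sub>R axis i 1)
    - partial i f (x + t *\<^sub>R axis i 1)" for t
  have "DERIV g t :> g' t" for t
    unfolding g_def g'_def by (intro DERIV_diff has_field_derivative_along_axis f)
  with MVT2[OF h, of g g'] obtain s where s: "0 < s" "s < h" "g h - g 0 = h * g' s"
    by auto
  define y where "y = x + s *\<^sub>R axis i 1"
  have "DERIV (\<lambda>t. partial i f (y + t *\<^sub>R axis j 1)) t
      :> partial j (partial i f) (y + t *\<^sub>R axis j 1)" for t
    by (intro has_field_derivative_along_axis Cinf_partial f)
  from MVT2[OF h this] obtain t where t: "0 < t" "t < h"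
    "partial i f (y + h *\<^sub>R axis j 1) - partial i f y = h * partial j (partial i f) (y + t *\<^sub>R axis j 1)"
    by auto
  have "g' s = partial i f (y + h *\<^sub>R axis j 1) - partial i f y"
    by (simp add: g'_def y_def algebra_simps)
  with s t have "g h - g 0 = h * h * partial j (partial i f) (y + t *\<^sub>R axis j 1)"
    by simp
  moreover have "g h - g 0 = f (x + h *\<^sub>R axis i 1 + h *\<^sub>R axis j 1)
      - f (x + h *\<^sub>R axis i 1) - f (x + h *\<^sub>R axis j 1) + f x"
    by (simp add: g_def algebra_simps)
  moreover have "dist (y + t *\<^sub>R axis j 1) x < 2 * h"
  proof -
    have "dist (y + t *\<^sub>R axis j 1) x = norm (s *\<^sub>R axis i (1::real) + t *\<^sub>R axis j 1 :: real^'m)"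
      by (simp add: y_def dist_norm algebra_simps)
    also have "\<dots> \<le> s + t"
      using norm_triangle_ineq[of "s *\<^sub>R axis i (1::real) :: real^'m" "t *\<^sub>R axis j 1"] s t by simp
    finally show ?thesis using s t by simp
  qed
  ultimately show ?thesis
    by (intro exI[of _ "y + t *\<^sub>R axis j 1"]) simp
qed

text \<open>Both mixed derivatives, each at some point near x, equal the same second difference
  divided by \<open>h * h\<close>; continuity at x then forbids a gap between them.\<close>

lemma partial_commute:
  fixes f :: "real^'m \<Rightarrow> real"
  assumes f: "f \<in> Cinf"
  shows "partial i (partial j f) = partial j (partial i f)"
proof (rule ext, rule ccontr)
  fix x
  define u v where "u = partial i (partial j f)" and "v = partial j (partial i f)"
  assume "partial i (partial j f) x \<noteq> partial j (partial i f) x"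
  \<comment> \<open>Half the gap is the tolerance: two errors below it cannot add up to the
    gap.\<close>
  then have e: "\<bar>u x - v x\<bar> / 2 > 0" (is "?e > 0") by (simp add: u_def v_def)
  have "isCont u x" "isCont v x"
    unfolding u_def v_def
    by (rule differentiable_imp_continuous_within
        [OF Cinf_differentiable[OF Cinf_partial[OF Cinf_partial[OF f]]]])+
  note cont = this[unfolded continuous_at_eps_delta, rule_format, OF e]
  obtain d1 where d1: "d1 > 0" "\<forall>y. dist y x < d1 \<longrightarrow> dist (u y) (u x) < ?e"
    using cont(1) by blast
  obtain d2 where d2: "d2 > 0" "\<forall>y. dist y x < d2 \<longrightarrow> dist (v y) (v x) < ?e"
    using cont(2) by blast
  note d = d1 d2
  define h where "h = min d1 d2 / 2"
  have h: "h > 0" "2 * h \<le> d1" "2 * h \<le> d2" using d by (auto simp: h_def)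
  obtain p where p: "dist p x < 2 * h"
    "f (x + h *\<^sub>R axis i 1 + h *\<^sub>R axis j 1) - f (x + h *\<^sub>R axis i 1) - f (x + h *\<^sub>R axis j 1) + f x
      = h * h * v p"
    using second_difference_MVT[OF f h(1), of x i j] unfolding v_def by blast
  obtain q where q: "dist q x < 2 * h"
    "f (x + h *\<^sub>R axis j 1 + h *\<^sub>R axis i 1) - f (x + h *\<^sub>R axis j 1) - f (x + h *\<^sub>R axis i 1) + f x
      = h * h * u q"
    using second_difference_MVT[OF f h(1), of x j i] unfolding u_def by blast
  have "h * h * v p = h * h * u q"
    using p(2) q(2) by (simp add: algebra_simps)
  then have "v p = u q" using h by simp
  moreover have "dist (v p) (v x) < ?e" "dist (u q) (u x) < ?e"
    using p q d h by auto
  moreover have "\<bar>u x - v x\<bar> \<le> \<bar>v p - v x\<bar> + \<bar>u q - u x\<bar>"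
    using abs_triangle_ineq4[of "v p - v x" "u q - u x"] \<open>v p = u q\<close> by simp
  ultimately show False
    unfolding dist_real_def by argo
qed

section \<open>Multi-indices and iterated partial derivatives\<close>

definition mi_inc :: "'m \<Rightarrow> ('m \<Rightarrow> nat) \<Rightarrow> ('m \<Rightarrow> nat)"
  where "mi_inc i \<alpha> = \<alpha>(i := Suc (\<alpha> i))"

text \<open>Truncated subtraction makes this total. For \<alpha> i = 0 the value is meaningless, and
  formulas using it carry a factor \<open>real (\<alpha> i)\<close> or a case split that removes
  it.\<close>

definition mi_dec :: "'m \<Rightarrow> ('m \<Rightarrow> nat) \<Rightarrow> ('m \<Rightarrow> nat)"
  where "mi_dec i \<alpha> = \<alpha>(i := \<alpha> i - 1)"

definition mi_fact :: "('m::finite \<Rightarrow> nat) \<Rightarrow> real"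
  where "mi_fact \<alpha> = (\<Prod>i\<in>UNIV. fact (\<alpha> i))"

lemma mi_dec_inc [simp]: "mi_dec i (mi_inc i \<alpha>) = \<alpha>"
  by (simp add: mi_inc_def mi_dec_def)

lemma mi_inc_dec [simp]: "\<alpha> i \<noteq> 0 \<Longrightarrow> mi_inc i (mi_dec i \<alpha>) = \<alpha>"
  by (simp add: mi_inc_def mi_dec_def)

lemma mi_inc_apply: "mi_inc i \<alpha> j = (if i = j then Suc (\<alpha> j) else \<alpha> j)"
  by (simp add: mi_inc_def)

lemma mi_inc_apply_same [simp]: "mi_inc i \<alpha> i = Suc (\<alpha> i)"
  by (simp add: mi_inc_def)

lemma mi_dec_apply: "mi_dec i \<alpha> j = (if i = j then \<alpha> j - 1 else \<alpha> j)"
  by (simp add: mi_dec_def)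

lemma mi_inc_commute: "mi_inc i (mi_inc j \<alpha>) = mi_inc j (mi_inc i \<alpha>)"
  by (auto simp: mi_inc_def)

lemma mi_inc_dec_commute: "i \<noteq> j \<Longrightarrow> mi_inc i (mi_dec j \<alpha>) = mi_dec j (mi_inc i \<alpha>)"
  by (auto simp: mi_inc_def mi_dec_def)

lemma mi_abs_inc [simp]: "mi_abs (mi_inc i \<alpha>) = Suc (mi_abs \<alpha>)"
  unfolding mi_abs_def mi_inc_def
  by (subst (1 2) sum.remove[of _ i]) auto

lemma mi_abs_dec: "\<alpha> i \<noteq> 0 \<Longrightarrow> Suc (mi_abs (mi_dec i \<alpha>)) = mi_abs \<alpha>"
  by (metis mi_abs_inc mi_inc_dec)

lemma mi_abs_0 [simp]: "mi_abs (\<lambda>_. 0) = 0"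
  by (simp add: mi_abs_def)

lemma mi_abs_eq_0: "mi_abs \<alpha> = 0 \<longleftrightarrow> \<alpha> = (\<lambda>_. 0)"
  by (auto simp: mi_abs_def)

lemma mi_fact_nonzero [simp]: "mi_fact \<alpha> \<noteq> 0"
  by (simp add: mi_fact_def)

lemma mi_fact_dec: "\<alpha> i \<noteq> 0 \<Longrightarrow> real (\<alpha> i) * mi_fact (mi_dec i \<alpha>) = mi_fact \<alpha>"
proof -
  assume "\<alpha> i \<noteq> 0"
  then obtain n where n: "\<alpha> i = Suc n" by (cases "\<alpha> i") auto
  have "(\<Prod>j\<in>UNIV - {i}. fact (mi_dec i \<alpha> j)) = (\<Prod>j\<in>UNIV - {i}. fact (\<alpha> j) :: real)"
    by (rule prod.cong) (auto simp: mi_dec_apply)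
  then show ?thesis
    unfolding mi_fact_def by (subst (1 2) prod.remove[of _ i]) (auto simp: mi_dec_apply n)
qed

lemma mi_induct [case_names zero inc]:
  fixes \<alpha> :: "'m::finite \<Rightarrow> nat"
  assumes "P (\<lambda>_. 0)" "\<And>i \<alpha>. P \<alpha> \<Longrightarrow> P (mi_inc i \<alpha>)"
  shows "P \<alpha>"
proof (induction "mi_abs \<alpha>" arbitrary: \<alpha>)
  case 0
  then have "\<alpha> = (\<lambda>_. 0)" using mi_abs_eq_0[of \<alpha>] by simp
  then show ?case using assms(1) by simp
next
  case (Suc n)
  then have "\<alpha> \<noteq> (\<lambda>_. 0)" by auto
  then obtain i where i: "\<alpha> i \<noteq> 0" by auto
  then have "P (mi_dec i \<alpha>)" using Suc(1)[of "mi_dec i \<alpha>"] Suc(2) mi_abs_dec[of \<alpha> i] by simp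
  from assms(2)[OF this, of i] show ?case unfolding mi_inc_dec[of \<alpha> i, OF i] .
qed

section \<open>Independence of iterated derivatives of their order\<close>

lemma foldr_partial_Cinf: "f \<in> Cinf \<Longrightarrow> foldr partial is f \<in> Cinf"
  by (induction "is") (auto intro: Cinf_partial)

lemma foldr_partial_remove1:
  fixes f :: "real^'m \<Rightarrow> real"
  assumes "f \<in> Cinf" "i \<in> set is"
  shows "foldr partial is f = partial i (foldr partial (remove1 i is) f)"
  using assms(2)
proof (induction "is")
  case (Cons j js)
  then show ?case
    using partial_commute[OF foldr_partial_Cinf[OF assms(1)], of j i] by auto
qed simp

lemma foldr_partial_mset:
  fixes f :: "real^'m \<Rightarrow> real"
  assumes "f \<in> Cinf" "mset is = mset js"
  shows "foldr partial is f = foldr partial js f"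
  using assms(2)
proof (induction "is" arbitrary: js)
  case (Cons i "is")
  then have i: "i \<in> set js" by (metis list.set_intros(1) set_mset_mset)
  from Cons.prems have "mset is = mset (remove1 i js)"
    by (metis add_mset_remove_trivial mset.simps(2) mset_remove1)
  from Cons.IH[OF this] show ?case
    unfolding foldr_partial_remove1[OF assms(1) i] by simp
qed simp

text \<open>This discharges the arbitrary choice in \<open>mi_partial\<close>: any list with the
  right multiplicities is a permutation of the chosen one.\<close>

lemma mi_partial_eq_foldr:
  fixes f :: "real^'m \<Rightarrow> real"
  assumes f: "f \<in> Cinf" and c: "\<And>i. count_list is i = \<alpha> i"
  shows "mi_partial \<alpha> f = foldr partial is f"
proof -
  have "\<forall>i. count_list (SOME is. \<forall>i. count_list is i = \<alpha> i) i = \<alpha> i"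
    by (rule someI_ex[OF ex_list_of_multi_index])
  then have "mset (SOME is. \<forall>i. count_list is i = \<alpha> i) = mset is"
    using c by (intro multiset_eqI) (simp add: count_mset)
  then show ?thesis
    unfolding mi_partial_def by (rule foldr_partial_mset[OF f])
qed

lemma mi_partial_0 [simp]: "f \<in> Cinf \<Longrightarrow> mi_partial (\<lambda>_. 0) f = f"
  for f :: "real^'m \<Rightarrow> real"
  by (subst mi_partial_eq_foldr[of f "[]"]) auto

lemma mi_partial_inc:
  fixes f :: "real^'m \<Rightarrow> real"
  assumes f: "f \<in> Cinf"
  shows "mi_partial (mi_inc i \<alpha>) f = partial i (mi_partial \<alpha> f)"
proof -
  obtain "is" where "is": "\<And>j. count_list is j = \<alpha> j" using ex_list_of_multi_index by metis
  then have "mi_partial (mi_inc i \<alpha>) f = foldr partial (i # is) f"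
    by (intro mi_partial_eq_foldr f) (auto simp: mi_inc_apply)
  also have "\<dots> = partial i (mi_partial \<alpha> f)"
    using mi_partial_eq_foldr[OF f "is"] by simp
  finally show ?thesis .
qed

text \<open>The new derivative acts first here and last in \<open>mi_partial_inc\<close>. Letting
  the operand absorb it is what turns composition with \<open>partial i\<close> into multiplication
  by \<xi>_i.\<close>

lemma mi_partial_inc':
  fixes f :: "real^'m \<Rightarrow> real"
  assumes f: "f \<in> Cinf"
  shows "mi_partial (mi_inc i \<alpha>) f = mi_partial \<alpha> (partial i f)"
proof -
  obtain "is" where "is": "\<And>j. count_list is j = \<alpha> j" using ex_list_of_multi_index by metis
  then have "mi_partial (mi_inc i \<alpha>) f = foldr partial (is @ [i]) f"
    by (intro mi_partial_eq_foldr f) (auto simp: mi_inc_apply)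
  also have "\<dots> = mi_partial \<alpha> (partial i f)"
    using mi_partial_eq_foldr[OF Cinf_partial[OF f] "is"] by simp
  finally show ?thesis .
qed

lemma mi_partial_Cinf: "f \<in> Cinf \<Longrightarrow> mi_partial \<alpha> f \<in> Cinf"
  for f :: "real^'m \<Rightarrow> real"
  unfolding mi_partial_def by (rule foldr_partial_Cinf)

lemma mi_partial_add:
  fixes f g :: "real^'m \<Rightarrow> real"
  assumes "f \<in> Cinf" "g \<in> Cinf"
  shows "mi_partial \<alpha> (\<lambda>x. f x + g x) = (\<lambda>x. mi_partial \<alpha> f x + mi_partial \<alpha> g x)"
proof (induction \<alpha> rule: mi_induct)
  case (inc i \<alpha>)
  then show ?case
    using assms by (auto simp: mi_partial_inc Cinf_add partial_add Cinf_differentiable mi_partial_Cinf)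
qed (use assms in \<open>simp add: Cinf_add\<close>)

lemma mi_partial_cmult:
  fixes f :: "real^'m \<Rightarrow> real"
  assumes "f \<in> Cinf"
  shows "mi_partial \<alpha> (\<lambda>x. c * f x) = (\<lambda>x. c * mi_partial \<alpha> f x)"
proof (induction \<alpha> rule: mi_induct)
  case (inc i \<alpha>)
  then show ?case
    using assms by (auto simp: mi_partial_inc Cinf_mult partial_cmult Cinf_differentiable mi_partial_Cinf)
qed (use assms in \<open>simp add: Cinf_mult\<close>)

text \<open>Leibniz stops after one correction because x_j is linear. The correction does to
  \<alpha> what d/d\<xi>_j does to the monomial with exponent \<alpha>; the whole symbol calculus
  grows from this.\<close>

lemma mi_partial_nth_mult:
  fixes f :: "real^'m \<Rightarrow> real"
  assumes f: "f \<in> Cinf"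
  shows "mi_partial \<alpha> (\<lambda>x. x $ j * f x)
    = (\<lambda>x. x $ j * mi_partial \<alpha> f x + real (\<alpha> j) * mi_partial (mi_dec j \<alpha>) f x)"
proof (induction \<alpha> rule: mi_induct)
  case zero
  show ?case using f by (simp add: Cinf_mult)
next
  case (inc i \<alpha>)
  have d: "mi_partial \<beta> f differentiable (at x)" for \<beta> x
    by (intro Cinf_differentiable mi_partial_Cinf f)
  have m: "(\<lambda>x. x $ j * mi_partial \<alpha> f x) differentiable (at x)"
    "(\<lambda>x. real (\<alpha> j) * mi_partial (mi_dec j \<alpha>) f x) differentiable (at x)" for x
    using mi_partial_Cinf[OF f] by (auto intro!: Cinf_differentiable)
  have "mi_partial (mi_inc i \<alpha>) (\<lambda>x. x $ j * f x) x =
      x $ j * partial i (mi_partial \<alpha> f) x + (if i = j then mi_partial \<alpha> f x else 0)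
      + real (\<alpha> j) * partial i (mi_partial (mi_dec j \<alpha>) f) x" for x
    using f by (simp add: mi_partial_inc Cinf_mult inc partial_add m partial_mult partial_cmult d)
  \<comment> \<open>For \<alpha> j = 0 both sides have the factor zero; that is the case in which
    \<open>mi_dec\<close> is not undone by \<open>mi_inc\<close>.\<close>
  moreover have "real (\<alpha> j) * partial i (mi_partial (mi_dec j \<alpha>) f) x
      = real (\<alpha> j) * mi_partial (mi_dec j (mi_inc i \<alpha>)) f x" for x
    by (cases "i = j"; cases "\<alpha> j = 0")
      (auto simp: mi_partial_inc[OF f, symmetric] mi_inc_dec_commute)
  moreover have "real (mi_inc i \<alpha> j) = real (\<alpha> j) + (if i = j then 1 else 0)"
    by (simp add: mi_inc_apply)
  ultimately show ?case
    by (auto simp: mi_partial_inc[OF f] algebra_simps)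
qed

section \<open>Centred monomials as test functions\<close>

lemma Cinf_mi_power: "(\<lambda>y::real^'m. mi_power (y - x) \<alpha>) \<in> Cinf"
  unfolding mi_power_def by (intro Cinf_prod Cinf_power) (auto intro: Cinf_diff)

lemma partial_mi_power:
  "partial i (\<lambda>y. mi_power (y - x) \<alpha>) = (\<lambda>y::real^'m. real (\<alpha> i) * mi_power (y - x) (mi_dec i \<alpha>))"
proof
  fix y :: "real^'m"
  let ?r = "\<lambda>y::real^'m. \<Prod>j\<in>UNIV - {i}. ((y - x) $ j) ^ \<alpha> j"
  have eq: "(\<lambda>y. mi_power (y - x) \<alpha>) = (\<lambda>y. ((y $ i - x $ i) ^ \<alpha> i) * ?r y)"
    unfolding mi_power_def by (rule ext, subst prod.remove[of _ i]) auto
  have eq': "mi_power (y - x) (mi_dec i \<alpha>) = ((y $ i - x $ i) ^ (\<alpha> i - 1)) * ?r y"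
    unfolding mi_power_def
    by (subst prod.remove[of _ i]) (auto simp: mi_dec_apply intro!: prod.cong)
  \<comment> \<open>The remaining factors do not involve y_i, so \<open>?r\<close> is constant along
    this axis; uniqueness of derivatives gives \<open>partial i ?r y = 0\<close>.\<close>
  have "?r (y + t *\<^sub>R axis i 1) = ?r y" for t
    by (rule prod.cong) (auto simp: axis_def)
  then have "((\<lambda>t. ?r (y + t *\<^sub>R axis i 1)) has_field_derivative 0) (at 0)"
    by simp
  moreover have r: "?r \<in> Cinf" by (intro Cinf_prod Cinf_power) (auto intro: Cinf_diff)
  ultimately have p0: "partial i ?r y = 0"
    using has_field_derivative_along_axis[OF r, of y i 0] by (auto intro: DERIV_unique)
  have d: "(\<lambda>y. (y $ i - x $ i)) differentiable (at y)" "(\<lambda>y. (y $ i - x $ i) ^ \<alpha> i) differentiable (at y)"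
    by (auto intro!: Cinf_differentiable Cinf_power Cinf_diff)
  have p1: "partial i (\<lambda>y. y $ i - x $ i) y = 1"
    using partial_add[of "\<lambda>y. y $ i" y "\<lambda>_. - x $ i" i] by simp
  have "partial i (\<lambda>y. mi_power (y - x) \<alpha>) y
      = partial i (\<lambda>y. (y $ i - x $ i) ^ \<alpha> i) y * ?r y + (y $ i - x $ i) ^ \<alpha> i * partial i ?r y"
    unfolding eq by (rule partial_mult[OF d(2) Cinf_differentiable[OF r]])
  also have "\<dots> = real (\<alpha> i) * mi_power (y - x) (mi_dec i \<alpha>)"
    unfolding p0 eq' partial_power[OF d(1)] p1 by simp
  finally show "partial i (\<lambda>y. mi_power (y - x) \<alpha>) y = real (\<alpha> i) * mi_power (y - x) (mi_dec i \<alpha>)" .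
qed

text \<open>Centred monomials are dual, up to factorials, to the derivatives at the centre. They
  isolate a single coefficient of an operator or of a symbol.\<close>

lemma mi_partial_mi_power:
  "mi_partial \<alpha> (\<lambda>y. mi_power (y - x) \<beta>) (x::real^'m) = (if \<alpha> = \<beta> then mi_fact \<beta> else 0)"
proof (induction \<alpha> arbitrary: \<beta> rule: mi_induct)
  case zero
  have "mi_power (0::real^'m) \<beta> = (if \<beta> = (\<lambda>_. 0) then 1 else 0)"
    by (auto simp: mi_power_def)
  then show ?case
    by (auto simp: Cinf_mi_power mi_fact_def)
next
  case (inc i \<alpha>)
  have "mi_partial (mi_inc i \<alpha>) (\<lambda>y. mi_power (y - x) \<beta>) x
      = real (\<beta> i) * (if \<alpha> = mi_dec i \<beta> then mi_fact (mi_dec i \<beta>) else 0)"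
    by (simp add: mi_partial_inc' Cinf_mi_power partial_mi_power mi_partial_cmult inc)
  moreover have "\<beta> i \<noteq> 0 \<Longrightarrow> \<alpha> = mi_dec i \<beta> \<longleftrightarrow> mi_inc i \<alpha> = \<beta>" by auto
  ultimately show ?case
    using mi_fact_dec[of \<beta> i] by (cases "\<beta> i = 0") auto
qed

section \<open>Symbol calculus on coefficient families\<close>

text \<open>A coefficient family \<open>a\<close> stands for the polynomial \<open>\<Sum>\<^sub>\<alpha> a\<^sub>\<alpha>(x) \<xi>\<^sup>\<alpha>\<close>; \<open>xi_mult\<close>, \<open>xi_deriv\<close> and
  \<open>fam_div\<close> are multiplication by \<open>\<xi>\<^sub>i\<close>, the derivative in \<open>\<xi>\<^sub>i\<close>, and the divergence of the header.\<close>

definition xi_mult :: "'m \<Rightarrow> (('m \<Rightarrow> nat) \<Rightarrow> real^'m \<Rightarrow> real) \<Rightarrow> ('m \<Rightarrow> nat) \<Rightarrow> real^'m \<Rightarrow> real"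
  where "xi_mult i a \<alpha> = (if \<alpha> i = 0 then (\<lambda>_. 0) else a (mi_dec i \<alpha>))"

definition xi_deriv :: "'m \<Rightarrow> (('m \<Rightarrow> nat) \<Rightarrow> real^'m \<Rightarrow> real) \<Rightarrow> ('m \<Rightarrow> nat) \<Rightarrow> real^'m \<Rightarrow> real"
  where "xi_deriv i a \<alpha> = (\<lambda>x. real (Suc (\<alpha> i)) * a (mi_inc i \<alpha>) x)"

definition fam_div :: "(('m \<Rightarrow> nat) \<Rightarrow> real^'m \<Rightarrow> real) \<Rightarrow> ('m \<Rightarrow> nat) \<Rightarrow> real^'m \<Rightarrow> real"
  where "fam_div a \<alpha> = (\<lambda>x. \<Sum>l\<in>UNIV. partial l (xi_deriv l a \<alpha>) x)"

definition quad_vf :: "('m \<Rightarrow> real) \<Rightarrow> ('m \<Rightarrow> 'm \<Rightarrow> real) \<Rightarrow> ('m \<Rightarrow> real) \<Rightarrow> real^'m \<Rightarrow> 'm \<Rightarrow> real"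
  where "quad_vf A B c x i = A i + (\<Sum>j\<in>UNIV. B i j * x $ j) + (\<Sum>j\<in>UNIV. c j * x $ j) * x $ i"

definition quad_jac :: "('m \<Rightarrow> 'm \<Rightarrow> real) \<Rightarrow> ('m \<Rightarrow> real) \<Rightarrow> real^'m \<Rightarrow> 'm \<Rightarrow> 'm \<Rightarrow> real"
  where "quad_jac B c x i j = B i j + (if i = j then \<Sum>l\<in>UNIV. c l * x $ l else 0) + c j * x $ i"

text \<open>The factor \<open>CARD('m) + 1\<close> is the source of the denominators in the theorem:
  the form c.x stands in each of the m diagonal entries of the Jacobian, and the entries c_i x_i add
  up to it once more.\<close>

definition quad_trace :: "('m \<Rightarrow> 'm \<Rightarrow> real) \<Rightarrow> ('m \<Rightarrow> real) \<Rightarrow> real^'m \<Rightarrow> real"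
  where "quad_trace B c x = (\<Sum>i\<in>UNIV. B i i) + (real CARD('m) + 1) * (\<Sum>l\<in>UNIV. c l * x $ l)"

text \<open>The Lie derivative of symbols, with \<rho>(DX) written as the sum of the operators DX_ij
  \<xi>_i d/d\<xi>_j. It keeps the degree in \<xi>, so families with components in several degrees
  are treated at once.\<close>

definition fam_lie :: "real \<Rightarrow> ('m \<Rightarrow> real) \<Rightarrow> ('m \<Rightarrow> 'm \<Rightarrow> real) \<Rightarrow> ('m \<Rightarrow> real)
    \<Rightarrow> (('m \<Rightarrow> nat) \<Rightarrow> real^'m \<Rightarrow> real) \<Rightarrow> ('m \<Rightarrow> nat) \<Rightarrow> real^'m \<Rightarrow> real"
  where "fam_lie d A B c a \<alpha> = (\<lambda>x.
      (\<Sum>i\<in>UNIV. quad_vf A B c x i * partial i (a \<alpha>) x)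
    - (\<Sum>i\<in>UNIV. \<Sum>j\<in>UNIV. quad_jac B c x i j * xi_mult i (xi_deriv j a) \<alpha> x)
    + d * quad_trace B c x * a \<alpha> x)"

definition fam_contract :: "('m \<Rightarrow> real) \<Rightarrow> (('m \<Rightarrow> nat) \<Rightarrow> real^'m \<Rightarrow> real) \<Rightarrow> ('m \<Rightarrow> nat) \<Rightarrow> real^'m \<Rightarrow> real"
  where "fam_contract c a \<alpha> = (\<lambda>x. \<Sum>j\<in>UNIV. c j * xi_deriv j a \<alpha> x)"

lemma quad_vf_Cinf [simp]: "(\<lambda>x::real^'m. quad_vf A B c x i) \<in> Cinf"
  unfolding quad_vf_def by (intro Cinf_add Cinf_mult Cinf_sum Cinf_const Cinf_nth)

lemma quad_jac_Cinf [simp]: "(\<lambda>x::real^'m. quad_jac B c x i j) \<in> Cinf"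
  unfolding quad_jac_def by (cases "i = j") (auto intro!: Cinf_add Cinf_mult Cinf_sum)

lemma quad_trace_Cinf [simp]: "(\<lambda>x::real^'m. quad_trace B c x) \<in> Cinf"
  unfolding quad_trace_def by (intro Cinf_add Cinf_mult Cinf_sum Cinf_const Cinf_nth)

lemma partial_linear_form: "partial l (\<lambda>x::real^'m. \<Sum>j\<in>UNIV. c j * x $ j) x = c l"
  by (subst partial_sum) (auto simp: partial_cmult Cinf_differentiable Cinf_mult if_distrib cong: if_cong)

lemma Cinf_linear_form: "(\<lambda>x::real^'m. \<Sum>j\<in>UNIV. c j * x $ j) \<in> Cinf"
  by (intro Cinf_mult Cinf_sum Cinf_const Cinf_nth)

lemma partial_quad_vf: "partial l (\<lambda>x::real^'m. quad_vf A B c x i) x = quad_jac B c x i l"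
proof -
  have d: "(\<lambda>x::real^'m. \<Sum>j\<in>UNIV. c j * x $ j) differentiable (at y)" for c y
    by (rule Cinf_differentiable[OF Cinf_linear_form])
  have d2: "(\<lambda>x::real^'m. (\<Sum>j\<in>UNIV. c j * x $ j) * x $ i) differentiable (at y)" for y
    by (intro Cinf_differentiable Cinf_mult Cinf_linear_form Cinf_nth)
  show ?thesis
    unfolding quad_vf_def quad_jac_def
    by (simp add: partial_add partial_mult partial_linear_form d d2 differentiable_add)
qed

lemma partial_quad_jac:
  "partial l (\<lambda>x::real^'m. quad_jac B c x i j) x
    = (if i = j then c l else 0) + (if i = l then c j else 0)"
proof -
  have d: "(\<lambda>x::real^'m. \<Sum>j\<in>UNIV. c j * x $ j) differentiable (at y)" for c y
    by (rule Cinf_differentiable[OF Cinf_linear_form])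
  have d2: "(\<lambda>x::real^'m. c j * x $ i) differentiable (at y)" for y
    by (intro Cinf_differentiable Cinf_mult Cinf_const Cinf_nth)
  show ?thesis
    unfolding quad_jac_def
    by (cases "i = j")
      (auto simp: partial_add partial_cmult partial_linear_form d d2 differentiable_add)
qed

lemma partial_quad_trace:
  "partial l (\<lambda>x::real^'m. quad_trace B c x) x = (real CARD('m) + 1) * c l"
  unfolding quad_trace_def
  by (subst partial_add)
    (auto simp: partial_cmult partial_linear_form Cinf_linear_form intro!: Cinf_differentiable Cinf_mult)

context
  fixes a :: "('m::finite \<Rightarrow> nat) \<Rightarrow> real^'m \<Rightarrow> real"
  assumes smooth: "\<And>\<alpha>. a \<alpha> \<in> Cinf"
begin

lemma xi_mult_Cinf: "xi_mult i a \<alpha> \<in> Cinf"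
  by (auto simp: xi_mult_def smooth)

lemma xi_deriv_Cinf: "xi_deriv i a \<alpha> \<in> Cinf"
  by (auto simp: xi_deriv_def smooth)

lemma fam_div_Cinf: "fam_div a \<alpha> \<in> Cinf"
  unfolding fam_div_def xi_deriv_def
  using Cinf_partial[OF Cinf_mult[OF Cinf_const smooth]] by (intro Cinf_sum)

lemma fam_lie_Cinf: "fam_lie d A B c a \<alpha> \<in> Cinf"
proof -
  have "xi_mult i (xi_deriv j a) \<alpha> \<in> Cinf" for i j
    by (auto simp: xi_mult_def xi_deriv_Cinf)
  then show ?thesis
    unfolding fam_lie_def
    by (intro Cinf_add Cinf_diff Cinf_sum Cinf_mult) (auto simp: smooth intro!: Cinf_partial)
qed

lemma fam_contract_Cinf: "fam_contract c a \<alpha> \<in> Cinf"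
  unfolding fam_contract_def by (intro Cinf_sum Cinf_mult Cinf_const xi_deriv_Cinf)

end

lemma xi_deriv_commute: "xi_deriv i (xi_deriv j a) = xi_deriv j (xi_deriv i a)"
  by (auto simp: xi_deriv_def fun_eq_iff mi_inc_commute[of i j] mi_inc_apply)

lemma xi_deriv_mult:
  "xi_deriv l (xi_mult i a) \<alpha> x = xi_mult i (xi_deriv l a) \<alpha> x + (if i = l then a \<alpha> x else 0)"
  by (cases "i = l"; cases "\<alpha> i = 0")
    (auto simp: xi_deriv_def xi_mult_def mi_inc_apply mi_dec_apply mi_inc_dec_commute algebra_simps)

lemma xi_euler: "(\<Sum>i\<in>UNIV. xi_mult i (xi_deriv i a) \<alpha> x) = real (mi_abs \<alpha>) * a \<alpha> x"
proof -
  have "xi_mult i (xi_deriv i a) \<alpha> x = real (\<alpha> i) * a \<alpha> x" for i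
    by (auto simp: xi_mult_def xi_deriv_def mi_dec_apply)
  then show ?thesis
    by (simp add: mi_abs_def sum_distrib_right)
qed

section \<open>Commutation of the divergence with the action\<close>

lemma xi_mult_deriv_div:
  fixes a :: "('m::finite \<Rightarrow> nat) \<Rightarrow> real^'m \<Rightarrow> real"
  assumes "\<And>\<alpha>. a \<alpha> \<in> Cinf"
  shows "xi_mult i (xi_deriv j (fam_div a)) \<alpha> x
    = (\<Sum>l\<in>UNIV. partial l (xi_mult i (xi_deriv j (xi_deriv l a)) \<alpha>) x)"
proof (cases "\<alpha> i = 0")
  case False
  let ?\<beta> = "mi_dec i \<alpha>"
  have d: "xi_deriv l a \<beta> differentiable (at x)" for \<beta> l
    by (intro Cinf_differentiable xi_deriv_Cinf assms)
  have "xi_mult i (xi_deriv j (fam_div a)) \<alpha> x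
      = (\<Sum>l\<in>UNIV. real (Suc (?\<beta> j)) * partial l (xi_deriv l a (mi_inc j ?\<beta>)) x)"
    using False by (simp add: xi_mult_def xi_deriv_def[of j] fam_div_def sum_distrib_left)
  also have "\<dots> = (\<Sum>l\<in>UNIV. partial l (xi_mult i (xi_deriv j (xi_deriv l a)) \<alpha>) x)"
    unfolding partial_cmult[OF d, symmetric]
    using False by (simp add: xi_mult_def xi_deriv_def[of j])
  finally show ?thesis .
qed (simp add: xi_mult_def)

text \<open>Among the ingredients of \<open>fam_lie\<close> only multiplication by \<xi>_l fails to
  commute with d/d\<xi>_l; the term with \<open>if i = l\<close> is that commutator.\<close>

lemma xi_deriv_fam_lie:
  fixes a :: "('m::finite \<Rightarrow> nat) \<Rightarrow> real^'m \<Rightarrow> real"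
  assumes "\<And>\<alpha>. a \<alpha> \<in> Cinf"
  shows "xi_deriv l (fam_lie d A B c a) \<alpha> = (\<lambda>x.
      (\<Sum>i\<in>UNIV. quad_vf A B c x i * partial i (xi_deriv l a \<alpha>) x)
    - (\<Sum>i\<in>UNIV. \<Sum>j\<in>UNIV. quad_jac B c x i j *
        (xi_mult i (xi_deriv j (xi_deriv l a)) \<alpha> x + (if i = l then xi_deriv j a \<alpha> x else 0)))
    + d * quad_trace B c x * xi_deriv l a \<alpha> x)"
proof
  fix x
  have d: "a \<beta> differentiable (at x)" for \<beta>
    using assms by (rule Cinf_differentiable)
  have p: "partial i (xi_deriv l a \<alpha>) x = real (Suc (\<alpha> l)) * partial i (a (mi_inc l \<alpha>)) x" for i
    unfolding xi_deriv_def by (rule partial_cmult[OF d])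
  have m: "real (Suc (\<alpha> l)) * xi_mult i (xi_deriv j a) (mi_inc l \<alpha>) x =
      xi_mult i (xi_deriv j (xi_deriv l a)) \<alpha> x + (if i = l then xi_deriv j a \<alpha> x else 0)" for i j
    using xi_deriv_mult[of l i "xi_deriv j a" \<alpha> x] xi_deriv_commute[of j l a]
    by (simp add: xi_deriv_def[of l "xi_mult i (xi_deriv j a)"])
  show "xi_deriv l (fam_lie d A B c a) \<alpha> x =
      (\<Sum>i\<in>UNIV. quad_vf A B c x i * partial i (xi_deriv l a \<alpha>) x)
    - (\<Sum>i\<in>UNIV. \<Sum>j\<in>UNIV. quad_jac B c x i j *
        (xi_mult i (xi_deriv j (xi_deriv l a)) \<alpha> x + (if i = l then xi_deriv j a \<alpha> x else 0)))
    + d * quad_trace B c x * xi_deriv l a \<alpha> x"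
    unfolding m[symmetric] p
    by (simp only: xi_deriv_def[of l] fam_lie_def distrib_left right_diff_distrib sum_distrib_left mult_ac)
qed

text \<open>Differentiating the components of the field and commuting d/d\<xi>_l past \<xi>_i both
  produce the Jacobian contracted with d_x d_\<xi>, with opposite signs, and these cancel. What
  survives are the derivatives of the Jacobian and of the trace, which are constants depending on c
  alone; hence affine fields commute with the divergence.\<close>

lemma fam_div_fam_lie:
  fixes a :: "('m::finite \<Rightarrow> nat) \<Rightarrow> real^'m \<Rightarrow> real"
  assumes smooth: "\<And>\<alpha>. a \<alpha> \<in> Cinf"
  shows "fam_div (fam_lie d A B c a) \<alpha> x = fam_lie d A B c (fam_div a) \<alpha> x
    + ((d - 1) * (real CARD('m) + 1) - 2 * real (mi_abs \<alpha>)) * fam_contract c a \<alpha> x"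
proof -
  let ?D = "\<lambda>l. xi_deriv l a \<alpha>" and ?X = "\<lambda>i j l. xi_mult i (xi_deriv j (xi_deriv l a)) \<alpha>"
  let ?V = "quad_vf A B c" and ?M = "quad_jac B c" and ?t = "quad_trace B c"
  have sD: "?D l \<in> Cinf" for l by (rule xi_deriv_Cinf[OF smooth])
  have sX: "?X i j l \<in> Cinf" for i j l
    by (intro xi_mult_Cinf xi_deriv_Cinf smooth)
  have step: "partial l (xi_deriv l (fam_lie d A B c a) \<alpha>) x =
      (\<Sum>i\<in>UNIV. ?M x i l * partial i (?D l) x) + (\<Sum>i\<in>UNIV. ?V x i * partial i (partial l (?D l)) x)
    - (\<Sum>i\<in>UNIV. \<Sum>j\<in>UNIV. ((if i = j then c l else 0) + (if i = l then c j else 0))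
          * (?X i j l x + (if i = l then ?D j x else 0)))
    - (\<Sum>i\<in>UNIV. \<Sum>j\<in>UNIV. ?M x i j * (partial l (?X i j l) x + (if i = l then partial l (?D j) x else 0)))
    + d * ((real CARD('m) + 1) * c l) * ?D l x + d * ?t x * partial l (?D l) x" for l
  proof -
    let ?f1 = "\<lambda>x. \<Sum>i\<in>UNIV. ?V x i * partial i (?D l) x"
    let ?g = "\<lambda>i j x. ?X i j l x + (if i = l then ?D j x else 0)"
    let ?f2 = "\<lambda>x. \<Sum>i\<in>UNIV. \<Sum>j\<in>UNIV. (- ?M x i j) * ?g i j x"
    let ?f3 = "\<lambda>x. d * ?t x * ?D l x"
    have sg: "?g i j \<in> Cinf" for i j
      by (cases "i = l") (use sX sD in auto)
    have dsum: "(\<lambda>y. f y * g y) differentiable (at x)" if "f \<in> Cinf" "g \<in> Cinf"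
      for f g :: "real^'m \<Rightarrow> real"
      using that by (intro Cinf_differentiable Cinf_mult)
    have p1: "partial l ?f1 x = (\<Sum>i\<in>UNIV. ?M x i l * partial i (?D l) x + ?V x i * partial i (partial l (?D l)) x)"
      by (subst partial_sum)
        (auto simp: dsum Cinf_partial sD partial_mult partial_quad_vf Cinf_differentiable
          partial_commute[OF sD, of l] intro!: sum.cong)
    have pg: "partial l (?g i j) x = partial l (?X i j l) x + (if i = l then partial l (?D j) x else 0)" for i j
      by (cases "i = l") (simp_all add: partial_add Cinf_differentiable sX sD)
    have pM: "partial l (\<lambda>x. - ?M x i j) x = - ((if i = j then c l else 0) + (if i = l then c j else 0))" for i j
      using partial_cmult[OF Cinf_differentiable[OF quad_jac_Cinf[of B c i j]], where c = "-1" and i = l and x = x]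
      by (simp add: partial_quad_jac)
    have p2: "partial l ?f2 x = (\<Sum>i\<in>UNIV. \<Sum>j\<in>UNIV.
        - (((if i = j then c l else 0) + (if i = l then c j else 0)) * ?g i j x)
        - ?M x i j * (partial l (?X i j l) x + (if i = l then partial l (?D j) x else 0)))"
    proof -
      have dm: "(\<lambda>x. (- ?M x i j) * ?g i j x) differentiable (at x)" for i j
        by (rule dsum[OF Cinf_minus[OF quad_jac_Cinf] sg])
      have "partial l (\<lambda>x. (- ?M x i j) * ?g i j x) x =
        - (((if i = j then c l else 0) + (if i = l then c j else 0)) * ?g i j x)
        - ?M x i j * (partial l (?X i j l) x + (if i = l then partial l (?D j) x else 0))" for i j
        unfolding partial_mult[OF Cinf_differentiable[OF Cinf_minus[OF quad_jac_Cinf]]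
            Cinf_differentiable[OF sg]] pg pM by simp
      then show ?thesis
        using Cinf_mult[OF Cinf_minus[OF quad_jac_Cinf] sg]
        by (simp only: partial_sum dm Cinf_differentiable Cinf_sum)
    qed
    have p3: "partial l ?f3 x = d * ((real CARD('m) + 1) * c l) * ?D l x + d * ?t x * partial l (?D l) x"
      using partial_mult[of "\<lambda>x. d * ?t x" x "?D l" l] sD[of l]
      by (simp add: partial_cmult Cinf_differentiable partial_quad_trace Cinf_mult)
    have eq: "xi_deriv l (fam_lie d A B c a) \<alpha> = (\<lambda>x. (?f1 x + ?f2 x) + ?f3 x)"
      unfolding xi_deriv_fam_lie[OF smooth] by (simp add: sum_negf fun_eq_iff)
    have s1: "?f1 \<in> Cinf" by (intro Cinf_sum Cinf_mult quad_vf_Cinf Cinf_partial sD)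
    have s2: "?f2 \<in> Cinf" by (intro Cinf_sum Cinf_mult Cinf_minus quad_jac_Cinf sg)
    have s3: "?f3 \<in> Cinf" by (intro Cinf_mult Cinf_const quad_trace_Cinf sD)
    have "partial l (xi_deriv l (fam_lie d A B c a) \<alpha>) x = partial l ?f1 x + partial l ?f2 x + partial l ?f3 x"
      unfolding eq using s1 s2 s3
      by (simp only: partial_add Cinf_differentiable Cinf_add)
    then show ?thesis
      unfolding p1 p2 p3 by (simp only: sum.distrib sum_subtractf sum_negf)
  qed
  have cross: "(\<Sum>l\<in>UNIV. \<Sum>i\<in>UNIV. ?M x i l * partial i (?D l) x)
      = (\<Sum>l\<in>UNIV. \<Sum>i\<in>UNIV. \<Sum>j\<in>UNIV. ?M x i j * (if i = l then partial l (?D j) x else 0))"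
  proof -
    have "(\<Sum>l\<in>UNIV. \<Sum>i\<in>UNIV. \<Sum>j\<in>UNIV. ?M x i j * (if i = l then partial l (?D j) x else 0))
        = (\<Sum>l\<in>UNIV. \<Sum>i\<in>UNIV. if i = l then (\<Sum>j\<in>UNIV. ?M x l j * partial l (?D j) x) else 0)"
      by (intro sum.cong) auto
    also have "\<dots> = (\<Sum>l\<in>UNIV. \<Sum>j\<in>UNIV. ?M x l j * partial l (?D j) x)"
      by simp
    also have "\<dots> = (\<Sum>l\<in>UNIV. \<Sum>i\<in>UNIV. ?M x i l * partial i (?D l) x)"
      by (rule sum.swap)
    finally show ?thesis by simp
  qed
  \<comment> \<open>Four sums occur. Two become \<open>mi_abs \<alpha>\<close> contractions each by
    Euler's identity, one is a single contraction, and one is a contraction repeated for each of the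
    m values of l.\<close>
  have const: "(\<Sum>l\<in>UNIV. \<Sum>i\<in>UNIV. \<Sum>j\<in>UNIV. ((if i = j then c l else 0) + (if i = l then c j else 0))
          * (?X i j l x + (if i = l then ?D j x else 0)))
      = (2 * real (mi_abs \<alpha>) + real CARD('m) + 1) * fam_contract c a \<alpha> x"
  proof -
    have "(\<Sum>i\<in>UNIV. \<Sum>j\<in>UNIV. ((if i = j then c l else 0) + (if i = l then c j else 0))
          * (?X i j l x + (if i = l then ?D j x else 0)))
      = (\<Sum>i\<in>UNIV. \<Sum>j\<in>UNIV. (if i = j then c l * ?X i i l x else 0))
      + (\<Sum>i\<in>UNIV. \<Sum>j\<in>UNIV. (if i = j then (if i = l then c l * ?D l x else 0) else 0))
      + (\<Sum>i\<in>UNIV. (if i = l then \<Sum>j\<in>UNIV. c j * ?X l j l x else 0))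
      + (\<Sum>i\<in>UNIV. (if i = l then \<Sum>j\<in>UNIV. c j * ?D j x else 0))" for l
    proof -
      have pull: "(if i = l then \<Sum>j\<in>UNIV. F j else 0) = (\<Sum>j\<in>UNIV. if i = l then F j else 0)"
        for i and F :: "'m \<Rightarrow> real"
        by simp
      show ?thesis
        unfolding pull sum.distrib[symmetric]
        by (intro sum.cong refl) (simp add: algebra_simps)
    qed
    also have "\<dots> l = c l * (real (mi_abs \<alpha>) * ?D l x) + c l * ?D l x + (\<Sum>j\<in>UNIV. c j * ?X l j l x)
        + fam_contract c a \<alpha> x" for l
      by (simp add: sum_distrib_left[symmetric] xi_euler fam_contract_def)
    finally have "(\<Sum>l\<in>UNIV. \<Sum>i\<in>UNIV. \<Sum>j\<in>UNIV. ((if i = j then c l else 0) + (if i = l then c j else 0))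
          * (?X i j l x + (if i = l then ?D j x else 0)))
      = real (mi_abs \<alpha>) * fam_contract c a \<alpha> x + fam_contract c a \<alpha> x
        + (\<Sum>l\<in>UNIV. \<Sum>j\<in>UNIV. c j * ?X l j l x) + real CARD('m) * fam_contract c a \<alpha> x"
      by (simp add: sum.distrib fam_contract_def sum_distrib_left mult_ac)
    also have "(\<Sum>l\<in>UNIV. \<Sum>j\<in>UNIV. c j * ?X l j l x) = (\<Sum>j\<in>UNIV. c j * (\<Sum>l\<in>UNIV. xi_mult l (xi_deriv l (xi_deriv j a)) \<alpha> x))"
      by (subst sum.swap) (simp add: sum_distrib_left xi_deriv_commute)
    also have "\<dots> = real (mi_abs \<alpha>) * fam_contract c a \<alpha> x"
      by (simp add: xi_euler fam_contract_def sum_distrib_left mult_ac)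
    finally show ?thesis by (simp add: algebra_simps)
  qed
  have Vterm: "(\<Sum>l\<in>UNIV. \<Sum>i\<in>UNIV. ?V x i * partial i (partial l (?D l)) x)
      = (\<Sum>i\<in>UNIV. ?V x i * partial i (fam_div a \<alpha>) x)"
  proof -
    have "partial i (fam_div a \<alpha>) x = (\<Sum>l\<in>UNIV. partial i (partial l (?D l)) x)" for i
      unfolding fam_div_def by (rule partial_sum) (intro Cinf_differentiable Cinf_partial sD)
    then show ?thesis
      by (subst sum.swap) (simp add: sum_distrib_left)
  qed
  have Mterm: "(\<Sum>l\<in>UNIV. \<Sum>i\<in>UNIV. \<Sum>j\<in>UNIV. ?M x i j * partial l (?X i j l) x)
      = (\<Sum>i\<in>UNIV. \<Sum>j\<in>UNIV. ?M x i j * xi_mult i (xi_deriv j (fam_div a)) \<alpha> x)"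
    unfolding xi_mult_deriv_div[OF smooth] sum_distrib_left
    by (subst sum.swap, rule sum.cong[OF refl], rule sum.swap)
  have Msplit: "(\<Sum>l\<in>UNIV. \<Sum>i\<in>UNIV. \<Sum>j\<in>UNIV. ?M x i j
        * (partial l (?X i j l) x + (if i = l then partial l (?D j) x else 0)))
      = (\<Sum>i\<in>UNIV. \<Sum>j\<in>UNIV. ?M x i j * xi_mult i (xi_deriv j (fam_div a)) \<alpha> x)
      + (\<Sum>l\<in>UNIV. \<Sum>i\<in>UNIV. ?M x i l * partial i (?D l) x)"
    unfolding distrib_left sum.distrib cross Mterm ..
  have cterm: "(\<Sum>l\<in>UNIV. d * ((real CARD('m) + 1) * c l) * ?D l x)
      = d * (real CARD('m) + 1) * fam_contract c a \<alpha> x"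
    by (simp add: fam_contract_def sum_distrib_left mult_ac)
  have tterm: "(\<Sum>l\<in>UNIV. d * ?t x * partial l (?D l) x) = d * ?t x * fam_div a \<alpha> x"
    by (simp add: fam_div_def sum_distrib_left)
  have "fam_div (fam_lie d A B c a) \<alpha> x = (\<Sum>l\<in>UNIV. partial l (xi_deriv l (fam_lie d A B c a) \<alpha>) x)"
    by (simp add: fam_div_def)
  also have "\<dots> = fam_lie d A B c (fam_div a) \<alpha> x
     - (2 * real (mi_abs \<alpha>) + real CARD('m) + 1) * fam_contract c a \<alpha> x
     + d * (real CARD('m) + 1) * fam_contract c a \<alpha> x"
    unfolding step sum.distrib sum_subtractf const Vterm cterm tterm Msplit fam_lie_def by simp
  finally show ?thesis by (simp add: algebra_simps)
qed

text \<open>Contraction with the constant c commutes with the divergence. As \<open>fam_div\<close>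
  reads coefficients one degree higher, a weight depending on the degree comes out evaluated at the
  successor.\<close>

lemma fam_div_contract:
  fixes a :: "('m::finite \<Rightarrow> nat) \<Rightarrow> real^'m \<Rightarrow> real"
  assumes smooth: "\<And>\<alpha>. a \<alpha> \<in> Cinf"
  shows "fam_div (\<lambda>\<alpha> x. w (mi_abs \<alpha>) * fam_contract c a \<alpha> x) \<alpha> x
    = w (Suc (mi_abs \<alpha>)) * fam_contract c (fam_div a) \<alpha> x"
proof -
  have eq: "xi_deriv l (\<lambda>\<alpha> x. w (mi_abs \<alpha>) * fam_contract c a \<alpha> x) \<alpha>
      = (\<lambda>x. \<Sum>j\<in>UNIV. (w (Suc (mi_abs \<alpha>)) * c j * real (Suc (\<alpha> j))) * xi_deriv l a (mi_inc j \<alpha>) x)" for l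
  proof
    fix x
    have comm: "real (Suc (\<alpha> l)) * (c j * xi_deriv j a (mi_inc l \<alpha>) x)
        = c j * real (Suc (\<alpha> j)) * xi_deriv l a (mi_inc j \<alpha>) x" for j
      by (cases "j = l") (simp_all add: xi_deriv_def mi_inc_apply mi_inc_commute[of j l])
    have "xi_deriv l (\<lambda>\<alpha> x. w (mi_abs \<alpha>) * fam_contract c a \<alpha> x) \<alpha> x
        = w (Suc (mi_abs \<alpha>)) * (real (Suc (\<alpha> l)) * fam_contract c a (mi_inc l \<alpha>) x)"
      by (simp add: xi_deriv_def[of l "\<lambda>\<alpha> x. w (mi_abs \<alpha>) * fam_contract c a \<alpha> x"])
    also have "\<dots> = w (Suc (mi_abs \<alpha>)) *
        (\<Sum>j\<in>UNIV. c j * real (Suc (\<alpha> j)) * xi_deriv l a (mi_inc j \<alpha>) x)"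
      unfolding fam_contract_def sum_distrib_left[of "real (Suc (\<alpha> l))"] comm ..
    finally show "xi_deriv l (\<lambda>\<alpha> x. w (mi_abs \<alpha>) * fam_contract c a \<alpha> x) \<alpha> x
      = (\<Sum>j\<in>UNIV. (w (Suc (mi_abs \<alpha>)) * c j * real (Suc (\<alpha> j))) * xi_deriv l a (mi_inc j \<alpha>) x)"
      by (simp only: sum_distrib_left mult.assoc)
  qed
  have sD: "xi_deriv l a \<beta> \<in> Cinf" for l \<beta> by (rule xi_deriv_Cinf[OF smooth])
  have "partial l (xi_deriv l (\<lambda>\<alpha> x. w (mi_abs \<alpha>) * fam_contract c a \<alpha> x) \<alpha>) x
      = (\<Sum>j\<in>UNIV. (w (Suc (mi_abs \<alpha>)) * c j * real (Suc (\<alpha> j))) * partial l (xi_deriv l a (mi_inc j \<alpha>)) x)" for l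
    unfolding eq
    by (subst partial_sum)
      (use sD in \<open>auto intro!: sum.cong Cinf_differentiable simp: partial_cmult Cinf_differentiable\<close>)
  then have "fam_div (\<lambda>\<alpha> x. w (mi_abs \<alpha>) * fam_contract c a \<alpha> x) \<alpha> x
      = (\<Sum>j\<in>UNIV. \<Sum>l\<in>UNIV. (w (Suc (mi_abs \<alpha>)) * c j * real (Suc (\<alpha> j)))
          * partial l (xi_deriv l a (mi_inc j \<alpha>)) x)"
    unfolding fam_div_def by (subst sum.swap) simp
  also have "\<dots> = w (Suc (mi_abs \<alpha>)) * fam_contract c (fam_div a) \<alpha> x"
    unfolding fam_contract_def xi_deriv_def[of _ "fam_div a"] fam_div_def sum_distrib_left
    by (simp only: mult.assoc)
  finally show ?thesis .
qed

lemma fam_div_add: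
  fixes a b :: "('m::finite \<Rightarrow> nat) \<Rightarrow> real^'m \<Rightarrow> real"
  assumes "\<And>\<alpha>. a \<alpha> \<in> Cinf" "\<And>\<alpha>. b \<alpha> \<in> Cinf"
  shows "fam_div (\<lambda>\<alpha> x. a \<alpha> x + b \<alpha> x) \<alpha> x = fam_div a \<alpha> x + fam_div b \<alpha> x"
proof -
  have "partial l (xi_deriv l (\<lambda>\<alpha> x. a \<alpha> x + b \<alpha> x) \<alpha>) x
      = partial l (xi_deriv l a \<alpha>) x + partial l (xi_deriv l b \<alpha>) x" for l
  proof -
    have "xi_deriv l (\<lambda>\<alpha> x. a \<alpha> x + b \<alpha> x) \<alpha> = (\<lambda>x. xi_deriv l a \<alpha> x + xi_deriv l b \<alpha> x)"
      by (simp add: xi_deriv_def distrib_left)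
    then show ?thesis
      using xi_deriv_Cinf[OF assms(1)] xi_deriv_Cinf[OF assms(2)]
      by (simp add: partial_add Cinf_differentiable)
  qed
  then show ?thesis by (simp add: fam_div_def sum.distrib)
qed

lemma fam_div_cmult:
  fixes a :: "('m::finite \<Rightarrow> nat) \<Rightarrow> real^'m \<Rightarrow> real"
  assumes "\<And>\<alpha>. a \<alpha> \<in> Cinf"
  shows "fam_div (\<lambda>\<alpha> x. r * a \<alpha> x) \<alpha> x = r * fam_div a \<alpha> x"
proof -
  have "partial l (xi_deriv l (\<lambda>\<alpha> x. r * a \<alpha> x) \<alpha>) x = r * partial l (xi_deriv l a \<alpha>) x" for l
  proof -
    have "xi_deriv l (\<lambda>\<alpha> x. r * a \<alpha> x) \<alpha> = (\<lambda>x. r * xi_deriv l a \<alpha> x)"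
      by (simp add: xi_deriv_def mult_ac)
    then show ?thesis
      using xi_deriv_Cinf[OF assms(1)] by (simp add: partial_cmult Cinf_differentiable)
  qed
  then show ?thesis by (simp add: fam_div_def sum_distrib_left)
qed

lemma funpow_div_Cinf:
  fixes a :: "('m::finite \<Rightarrow> nat) \<Rightarrow> real^'m \<Rightarrow> real"
  assumes "\<And>\<alpha>. a \<alpha> \<in> Cinf"
  shows "(fam_div ^^ n) a \<alpha> \<in> Cinf"
  using assms by (induction n arbitrary: \<alpha>) (auto intro: fam_div_Cinf)

lemma funpow_div_add:
  fixes a b :: "('m::finite \<Rightarrow> nat) \<Rightarrow> real^'m \<Rightarrow> real"
  assumes "\<And>\<alpha>. a \<alpha> \<in> Cinf" "\<And>\<alpha>. b \<alpha> \<in> Cinf"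
  shows "(fam_div ^^ n) (\<lambda>\<alpha> x. a \<alpha> x + b \<alpha> x) = (\<lambda>\<alpha> x. (fam_div ^^ n) a \<alpha> x + (fam_div ^^ n) b \<alpha> x)"
proof (induction n)
  case (Suc n)
  show ?case
    unfolding funpow.simps o_apply Suc.IH
    by (intro ext fam_div_add funpow_div_Cinf assms)
qed simp

lemma funpow_div_cmult:
  fixes a :: "('m::finite \<Rightarrow> nat) \<Rightarrow> real^'m \<Rightarrow> real"
  assumes "\<And>\<alpha>. a \<alpha> \<in> Cinf"
  shows "(fam_div ^^ n) (\<lambda>\<alpha> x. r * a \<alpha> x) = (\<lambda>\<alpha> x. r * (fam_div ^^ n) a \<alpha> x)"
proof (induction n)
  case (Suc n)
  show ?case
    unfolding funpow.simps o_apply Suc.IH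
    by (intro ext fam_div_cmult funpow_div_Cinf assms)
qed simp

text \<open>An arithmetic progression: each divergence adds the defect of
  \<open>fam_div_fam_lie\<close> at its own degree, and these degrees run from
  \<open>mi_abs \<alpha>\<close> to \<open>mi_abs \<alpha> + n\<close>. Their doubled average is
  \<open>2 * mi_abs \<alpha> + n\<close>.\<close>

lemma funpow_div_fam_lie:
  fixes a :: "('m::finite \<Rightarrow> nat) \<Rightarrow> real^'m \<Rightarrow> real"
  assumes smooth: "\<And>\<alpha>. a \<alpha> \<in> Cinf"
  shows "(fam_div ^^ Suc n) (fam_lie d A B c a) = (\<lambda>\<alpha> x. fam_lie d A B c ((fam_div ^^ Suc n) a) \<alpha> x
    + real (Suc n) * ((d - 1) * (real CARD('m) + 1) - 2 * real (mi_abs \<alpha>) - real n)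
      * fam_contract c ((fam_div ^^ n) a) \<alpha> x)"
proof (induction n)
  case 0
  show ?case by (simp add: fun_eq_iff fam_div_fam_lie[OF smooth])
next
  case (Suc n)
  define b where "b = (fam_div ^^ n) a"
  have sb: "b \<alpha> \<in> Cinf" "fam_div b \<alpha> \<in> Cinf" for \<alpha>
    using funpow_div_Cinf[OF smooth, of n] funpow_div_Cinf[OF smooth, of "Suc n"] by (simp_all add: b_def)
  \<comment> \<open>The coefficient in the induction hypothesis as a function of the degree, so that
    \<open>fam_div_contract\<close> can shift it by one.\<close>
  define w where "w r = real (Suc n) * ((d - 1) * (real CARD('m) + 1) - 2 * real r - real n)" for r :: nat
  have "(fam_div ^^ Suc (Suc n)) (fam_lie d A B c a)
      = fam_div (\<lambda>\<alpha> x. fam_lie d A B c (fam_div b) \<alpha> x + w (mi_abs \<alpha>) * fam_contract c b \<alpha> x)"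
    using Suc.IH by (simp add: b_def w_def)
  also have "\<dots> = (\<lambda>\<alpha> x. fam_lie d A B c (fam_div (fam_div b)) \<alpha> x
      + ((d - 1) * (real CARD('m) + 1) - 2 * real (mi_abs \<alpha>)) * fam_contract c (fam_div b) \<alpha> x
      + w (Suc (mi_abs \<alpha>)) * fam_contract c (fam_div b) \<alpha> x)"
    by (intro ext, subst fam_div_add)
      (auto simp: fam_div_fam_lie sb fam_div_contract intro!: fam_lie_Cinf fam_contract_Cinf)
  also have "\<dots> = (\<lambda>\<alpha> x. fam_lie d A B c ((fam_div ^^ Suc (Suc n)) a) \<alpha> x
    + real (Suc (Suc n)) * ((d - 1) * (real CARD('m) + 1) - 2 * real (mi_abs \<alpha>) - real (Suc n))
      * fam_contract c ((fam_div ^^ Suc n) a) \<alpha> x)"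
    by (auto simp: b_def w_def fun_eq_iff algebra_simps)
  finally show ?case .
qed

section \<open>Equivariance of the weighted divergence map\<close>

text \<open>The defect between the actions on operators and on symbols; only quadratic fields contribute.\<close>

definition fam_gamma :: "real \<Rightarrow> ('m \<Rightarrow> real) \<Rightarrow> (('m \<Rightarrow> nat) \<Rightarrow> real^'m \<Rightarrow> real) \<Rightarrow> ('m \<Rightarrow> nat) \<Rightarrow> real^'m \<Rightarrow> real"
  where "fam_gamma l c a \<alpha> = (\<lambda>x. - ((real (mi_abs \<alpha>) + l * (real CARD('m) + 1)) * fam_contract c a \<alpha> x))"

text \<open>On an operand concentrated in degree \<open>k\<close> this is \<open>\<Sum>\<^sub>j w\<^sub>j Div\<^sup>j\<close>, since \<open>Div\<^sup>j\<close> then lives in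
  degree \<open>k - j\<close>.\<close>

definition fam_lift :: "nat \<Rightarrow> (nat \<Rightarrow> real) \<Rightarrow> (('m \<Rightarrow> nat) \<Rightarrow> real^'m \<Rightarrow> real) \<Rightarrow> ('m \<Rightarrow> nat) \<Rightarrow> real^'m \<Rightarrow> real"
  where "fam_lift k w a \<alpha> = (if mi_abs \<alpha> \<le> k
    then (\<lambda>x. w (k - mi_abs \<alpha>) * (fam_div ^^ (k - mi_abs \<alpha>)) a \<alpha> x) else (\<lambda>_. 0))"

text \<open>The action preserves degree, so its value at \<alpha> sees only coefficients of the
  degree of \<alpha>, and a factor constant on that degree passes through. With r = 0 this also
  shows that a vanishing degree stays vanishing.\<close>

lemma fam_lie_scale:
  fixes a :: "('m::finite \<Rightarrow> nat) \<Rightarrow> real^'m \<Rightarrow> real"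
  assumes "\<And>\<alpha>. a \<alpha> \<in> Cinf" and b: "\<And>\<beta>. mi_abs \<beta> = mi_abs \<alpha> \<Longrightarrow> b \<beta> = (\<lambda>x. r * a \<beta> x)"
  shows "fam_lie d A B c b \<alpha> x = r * fam_lie d A B c a \<alpha> x"
proof -
  have 1: "partial i (b \<alpha>) x = r * partial i (a \<alpha>) x" for i
    using assms by (simp add: partial_cmult Cinf_differentiable)
  have 2: "xi_mult i (xi_deriv j b) \<alpha> x = r * xi_mult i (xi_deriv j a) \<alpha> x" for i j
    using b[of "mi_inc j (mi_dec i \<alpha>)"] mi_abs_dec[of \<alpha> i] by (simp add: xi_mult_def xi_deriv_def)
  show ?thesis
    unfolding fam_lie_def 1 2 using b[of \<alpha>]
    by (simp add: algebra_simps sum_distrib_left)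
qed

lemma fam_contract_scale:
  assumes "\<And>\<beta>. mi_abs \<beta> = Suc (mi_abs \<alpha>) \<Longrightarrow> b \<beta> = (\<lambda>x. r * a \<beta> x)"
  shows "fam_contract c b \<alpha> x = r * fam_contract c a \<alpha> x"
  using assms[of "mi_inc _ \<alpha>"]
  by (simp add: fam_contract_def xi_deriv_def algebra_simps sum_distrib_left)

lemma fam_lift_Cinf:
  fixes a :: "('m::finite \<Rightarrow> nat) \<Rightarrow> real^'m \<Rightarrow> real"
  assumes "\<And>\<alpha>. a \<alpha> \<in> Cinf"
  shows "fam_lift k w a \<alpha> \<in> Cinf"
  using funpow_div_Cinf[OF assms] by (auto simp: fam_lift_def)

text \<open>In degree k - j both sides contain w_j times the action on the j-th divergence. The rest
  is, on both sides, a multiple of the contracted (j-1)-st divergence, and the hypothesis on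
  \<open>w\<close> equates the two multiples.\<close>

lemma fam_lift_equivariant:
  fixes a :: "('m::finite \<Rightarrow> nat) \<Rightarrow> real^'m \<Rightarrow> real"
  assumes smooth: "\<And>\<alpha>. a \<alpha> \<in> Cinf" and le: "mi_abs \<alpha> \<le> k"
    and w: "\<And>j. 1 \<le> j \<Longrightarrow> j \<le> k \<Longrightarrow>
      w j * real j * (d * (real CARD('m) + 1) - (real CARD('m) + 2 * real k - real j))
      = - ((real k - real j + l * (real CARD('m) + 1)) * w (j - 1))"
  shows "fam_lift k w (fam_lie d A B c a) \<alpha> x
    = fam_lie d A B c (fam_lift k w a) \<alpha> x + fam_gamma l c (fam_lift k w a) \<alpha> x"
proof -
  define j where "j = k - mi_abs \<alpha>"
  have L: "fam_lie d A B c (fam_lift k w a) \<alpha> x = w j * fam_lie d A B c ((fam_div ^^ j) a) \<alpha> x"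
    by (rule fam_lie_scale) (use le in \<open>auto simp: j_def fam_lift_def intro: funpow_div_Cinf smooth\<close>)
  show ?thesis
  proof (cases j)
    \<comment> \<open>Top degree: the lift has nothing in degree k + 1 for the contraction to
      read.\<close>
    case 0
    then have "mi_abs \<alpha> = k" using le by (simp add: j_def)
    then have "fam_contract c (fam_lift k w a) \<alpha> x = 0 * fam_contract c a \<alpha> x"
      by (intro fam_contract_scale) (simp add: fam_lift_def)
    with L 0 le show ?thesis
      by (simp add: fam_gamma_def fam_lift_def j_def)
  next
    case (Suc n)
    then have deg: "real (mi_abs \<alpha>) = real k - real n - 1" "Suc (mi_abs \<alpha>) \<le> k" "k - Suc (mi_abs \<alpha>) = n"
      using le unfolding j_def by linarith+
    have C: "fam_contract c (fam_lift k w a) \<alpha> x = w n * fam_contract c ((fam_div ^^ n) a) \<alpha> x"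
      by (rule fam_contract_scale) (use deg in \<open>auto simp: fam_lift_def\<close>)
    have "fam_lift k w (fam_lie d A B c a) \<alpha> x = w j * (fam_div ^^ Suc n) (fam_lie d A B c a) \<alpha> x"
      using le Suc by (simp add: fam_lift_def j_def del: funpow.simps)
    \<comment> \<open>With \<open>mi_abs \<alpha>\<close> equal to k - j and n = j - 1, the bracket
      of \<open>funpow_div_fam_lie\<close> becomes \<open>d (m + 1) - (m + 2 k - j)\<close>.\<close>
    also have "\<dots> = w j * fam_lie d A B c ((fam_div ^^ j) a) \<alpha> x
      + (w j * real j * (d * (real CARD('m) + 1) - (real CARD('m) + 2 * real k - real j)))
        * fam_contract c ((fam_div ^^ n) a) \<alpha> x"
      unfolding funpow_div_fam_lie[OF smooth] deg(1) Suc
      by (simp add: algebra_simps del: funpow.simps)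
    also have "w j * real j * (d * (real CARD('m) + 1) - (real CARD('m) + 2 * real k - real j))
        = - ((real k - real j + l * (real CARD('m) + 1)) * w n)"
      using w[of j] Suc unfolding j_def by simp
    finally show ?thesis
      unfolding L fam_gamma_def C deg(1) Suc by (simp add: algebra_simps)
  qed
qed

section \<open>Total symbol of the Lie derivative of an operator\<close>

definition fam_op :: "nat \<Rightarrow> (('m \<Rightarrow> nat) \<Rightarrow> real^'m \<Rightarrow> real) \<Rightarrow> (real^'m \<Rightarrow> real) \<Rightarrow> real^'m \<Rightarrow> real"
  where "fam_op k a f x = (\<Sum>\<alpha> | mi_abs \<alpha> \<le> k. a \<alpha> x * mi_partial \<alpha> f x)"

lemma diff_op_eq: "diff_op k a = restrict (fam_op k a) Cinf"
  by (simp add: diff_op_def fam_op_def fun_eq_iff restrict_def)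

lemma fam_op_add: "f \<in> Cinf \<Longrightarrow> g \<in> Cinf \<Longrightarrow>
    fam_op k a (\<lambda>x. f x + g x) x = fam_op k a f x + fam_op k a g x"
  by (simp add: fam_op_def mi_partial_add distrib_left sum.distrib)

lemma fam_op_cmult: "f \<in> Cinf \<Longrightarrow> fam_op k a (\<lambda>x. r * f x) x = r * fam_op k a f x"
  by (simp add: fam_op_def mi_partial_cmult sum_distrib_left mult_ac)

lemma fam_op_sum:
  assumes "\<And>i. f i \<in> Cinf" "finite I"
  shows "fam_op k a (\<lambda>x. \<Sum>i\<in>I. f i x) x = (\<Sum>i\<in>I. fam_op k a (f i) x)"
  using assms(2)
proof induction
  case empty
  show ?case using fam_op_cmult[of "\<lambda>_. 0" k a 0 x] by simp
next
  case (insert i I)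
  then show ?case using assms(1) by (simp add: fam_op_add Cinf_sum)
qed

text \<open>Reindexing by one unit in direction i inside the bounded range. The two vanishing
  conditions handle the boundary: indices not reached by the shift, and indices shifted out of the
  range.\<close>

lemma sum_mi_shift:
  fixes g h :: "('m::finite \<Rightarrow> nat) \<Rightarrow> real"
  assumes g: "\<And>\<alpha>. mi_abs \<alpha> \<le> k \<Longrightarrow> \<alpha> i = 0 \<Longrightarrow> g \<alpha> = 0"
    and h: "\<And>\<alpha>. mi_abs \<alpha> = k \<Longrightarrow> h \<alpha> = 0"
    and gh: "\<And>\<alpha>. mi_abs \<alpha> < k \<Longrightarrow> g (mi_inc i \<alpha>) = h \<alpha>"
  shows "(\<Sum>\<alpha> | mi_abs \<alpha> \<le> k. g \<alpha>) = (\<Sum>\<alpha> | mi_abs \<alpha> \<le> k. h \<alpha>)"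
proof -
  have "(\<Sum>\<alpha> | mi_abs \<alpha> \<le> k. g \<alpha>) = (\<Sum>\<alpha> | mi_abs \<alpha> \<le> k \<and> \<alpha> i \<noteq> 0. g \<alpha>)"
    by (rule sum.mono_neutral_right) (auto simp: g finite_mi_abs_le)
  also have "\<dots> = (\<Sum>\<alpha> | mi_abs \<alpha> < k. h \<alpha>)"
    by (rule sum.reindex_bij_witness[of _ "mi_inc i" "mi_dec i"])
      (auto simp: mi_abs_dec gh[symmetric] Suc_le_eq[symmetric])
  also have "\<dots> = (\<Sum>\<alpha> | mi_abs \<alpha> \<le> k. h \<alpha>)"
    by (rule sum.mono_neutral_left) (auto simp: h finite_mi_abs_le)
  finally show ?thesis .
qed

text \<open>The commutator with multiplication by x_j is d/d\<xi>_j of the symbol. Coefficients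
  beyond degree k must vanish, since the \<xi>-derivative in degree k reads them.\<close>

lemma fam_op_nth_mult:
  fixes f :: "real^'m \<Rightarrow> real"
  assumes a: "\<And>\<alpha>. mi_abs \<alpha> > k \<Longrightarrow> a \<alpha> = (\<lambda>_. 0)" and f: "f \<in> Cinf"
  shows "fam_op k a (\<lambda>x. x $ j * f x) x = x $ j * fam_op k a f x + fam_op k (xi_deriv j a) f x"
proof -
  have "(\<Sum>\<alpha> | mi_abs \<alpha> \<le> k. a \<alpha> x * (real (\<alpha> j) * mi_partial (mi_dec j \<alpha>) f x))
      = fam_op k (xi_deriv j a) f x"
    unfolding fam_op_def
    by (rule sum_mi_shift[where i = j]) (use a in \<open>auto simp: xi_deriv_def\<close>)
  then have "fam_op k a (\<lambda>x. x $ j * f x) x = (\<Sum>\<alpha> | mi_abs \<alpha> \<le> k. a \<alpha> x * (x $ j * mi_partial \<alpha> f x))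
      + fam_op k (xi_deriv j a) f x"
    by (simp add: fam_op_def[of k a] mi_partial_nth_mult[OF f] distrib_left sum.distrib)
  then show ?thesis
    by (simp add: fam_op_def sum_distrib_left mult_ac)
qed

text \<open>Composition with a derivative raises the order, so degree k has to be empty for the
  product with \<xi>_i to stay within order k.\<close>

lemma fam_op_partial:
  fixes f :: "real^'m \<Rightarrow> real"
  assumes a: "\<And>\<alpha>. mi_abs \<alpha> \<ge> k \<Longrightarrow> a \<alpha> = (\<lambda>_. 0)" and f: "f \<in> Cinf"
  shows "fam_op k a (partial i f) x = fam_op k (xi_mult i a) f x"
  unfolding fam_op_def
  by (rule sum_mi_shift[where i = i, symmetric]) (use a in \<open>auto simp: xi_mult_def mi_partial_inc'[OF f]\<close>)

lemma partial_fam_op: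
  fixes f :: "real^'m \<Rightarrow> real"
  assumes a: "\<And>\<alpha>. a \<alpha> \<in> Cinf" and f: "f \<in> Cinf"
  shows "partial i (fam_op k a f) x = fam_op k (\<lambda>\<alpha>. partial i (a \<alpha>)) f x + fam_op k a (partial i f) x"
proof -
  have "partial i (fam_op k a f) x = partial i (\<lambda>x. \<Sum>\<alpha> | mi_abs \<alpha> \<le> k. a \<alpha> x * mi_partial \<alpha> f x) x"
    by (simp add: fam_op_def[abs_def])
  also have "\<dots> = (\<Sum>\<alpha> | mi_abs \<alpha> \<le> k. partial i (\<lambda>x. a \<alpha> x * mi_partial \<alpha> f x) x)"
    using a f by (intro partial_sum Cinf_differentiable Cinf_mult mi_partial_Cinf)
  also have "\<dots> = (\<Sum>\<alpha> | mi_abs \<alpha> \<le> k. partial i (a \<alpha>) x * mi_partial \<alpha> f x + a \<alpha> x * mi_partial \<alpha> (partial i f) x)"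
    using a f by (intro sum.cong refl)
      (simp add: partial_mult Cinf_differentiable mi_partial_Cinf mi_partial_inc[symmetric] mi_partial_inc')
  finally show ?thesis by (simp add: fam_op_def sum.distrib)
qed

lemma fam_op_lincomb:
  "fam_op k (\<lambda>\<alpha> x. \<Sum>i\<in>I. h i x * b i \<alpha> x) f x = (\<Sum>i\<in>I. h i x * fam_op k (b i) f x)"
  unfolding fam_op_def sum_distrib_right sum_distrib_left
  by (subst sum.swap) (simp add: mult_ac)

lemma fam_op_nth_mult2:
  fixes f :: "real^'m \<Rightarrow> real"
  assumes a: "\<And>\<alpha>. mi_abs \<alpha> > k \<Longrightarrow> a \<alpha> = (\<lambda>_. 0)" and f: "f \<in> Cinf"
  shows "fam_op k a (\<lambda>x. x $ j * (x $ i * f x)) x = x $ j * x $ i * fam_op k a f x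
    + x $ j * fam_op k (xi_deriv i a) f x + x $ i * fam_op k (xi_deriv j a) f x
    + fam_op k (xi_deriv i (xi_deriv j a)) f x"
proof -
  have "xi_deriv j a \<alpha> = (\<lambda>_. 0)" if "mi_abs \<alpha> > k" for \<alpha>
    using a[of "mi_inc j \<alpha>"] that by (simp add: xi_deriv_def)
  note z = this
  have "(\<lambda>x. x $ i * f x) \<in> Cinf" using f by (intro Cinf_mult Cinf_nth)
  from fam_op_nth_mult[OF a this] show ?thesis
    by (simp only: fam_op_nth_mult[OF a f] fam_op_nth_mult[OF z f]) (simp add: algebra_simps)
qed

text \<open>Moving the field through the operator costs \<xi>-derivatives. Those of first order
  belong to \<open>fam_lie\<close>; those of second order arise from the quadratic part only and
  give the degree in \<open>fam_gamma\<close>, while its l-term comes from moving the divergence of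
  the field.\<close>

lemma fam_op_lie:
  fixes f :: "real^'m \<Rightarrow> real"
  assumes smooth: "\<And>\<alpha>. a \<alpha> \<in> Cinf" and a: "\<And>\<alpha>. mi_abs \<alpha> > k \<Longrightarrow> a \<alpha> = (\<lambda>_. 0)" and f: "f \<in> Cinf"
  shows "(\<Sum>i\<in>UNIV. quad_vf A B c x i * partial i (fam_op k a f) x) + mu * quad_trace B c x * fam_op k a f x
    - fam_op k a (\<lambda>x. (\<Sum>i\<in>UNIV. quad_vf A B c x i * partial i f x) + l * quad_trace B c x * f x) x
    = fam_op k (\<lambda>\<alpha> x. fam_lie (mu - l) A B c a \<alpha> x + fam_gamma l c a \<alpha> x) f x"
proof -
  let ?O = "fam_op k a" and ?D = "\<lambda>j. fam_op k (xi_deriv j a)" and ?g = "\<lambda>i. partial i f"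
  let ?V = "quad_vf A B c" and ?M = "quad_jac B c" and ?t = "quad_trace B c"
  have g: "?g i \<in> Cinf" for i using f by (rule Cinf_partial)
  have z: "xi_deriv j a \<alpha> = (\<lambda>_. 0)" if "mi_abs \<alpha> \<ge> k" for \<alpha> j
    using a[of "mi_inc j \<alpha>"] that by (simp add: xi_deriv_def)
  have z2: "xi_deriv i (xi_deriv j a) \<alpha> = (\<lambda>_. 0)" if "mi_abs \<alpha> \<ge> k" for \<alpha> i j
    using z[of "mi_inc i \<alpha>"] that by (simp add: xi_deriv_def[of i])
  \<comment> \<open>An expansion by the value, the first and the second derivatives of
    \<open>?V\<close>; it ends there because the field is quadratic.\<close>
  have V: "?O (\<lambda>x. ?V x i * ?g i x) x = ?V x i * ?O (?g i) x + (\<Sum>j\<in>UNIV. ?M x i j * ?D j (?g i) x)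
      + (\<Sum>j\<in>UNIV. c j * fam_op k (xi_deriv i (xi_deriv j a)) (?g i) x)" for i
  proof -
    have "(\<lambda>x. ?V x i * ?g i x) = (\<lambda>x. (A i * ?g i x + (\<Sum>j\<in>UNIV. B i j * (x $ j * ?g i x)))
        + (\<Sum>j\<in>UNIV. c j * (x $ j * (x $ i * ?g i x))))"
      by (simp add: quad_vf_def algebra_simps sum_distrib_left sum_distrib_right)
    then have "?O (\<lambda>x. ?V x i * ?g i x) x = A i * ?O (?g i) x
        + (\<Sum>j\<in>UNIV. B i j * ?O (\<lambda>x. x $ j * ?g i x) x)
        + (\<Sum>j\<in>UNIV. c j * ?O (\<lambda>x. x $ j * (x $ i * ?g i x)) x)"
      using g[of i] by (simp add: fam_op_add fam_op_sum fam_op_cmult Cinf_add Cinf_sum Cinf_mult)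
    also have "\<dots> = A i * ?O (?g i) x
        + (\<Sum>j\<in>UNIV. B i j * (x $ j * ?O (?g i) x + ?D j (?g i) x))
        + (\<Sum>j\<in>UNIV. c j * (x $ j * x $ i * ?O (?g i) x + x $ j * ?D i (?g i) x + x $ i * ?D j (?g i) x
            + fam_op k (xi_deriv i (xi_deriv j a)) (?g i) x))"
      by (simp only: fam_op_nth_mult[OF a g] fam_op_nth_mult2[OF a g])
    also have "\<dots> = ?V x i * ?O (?g i) x
        + ((\<Sum>j\<in>UNIV. B i j * ?D j (?g i) x) + (\<Sum>j\<in>UNIV. c j * x $ j) * ?D i (?g i) x
          + (\<Sum>j\<in>UNIV. c j * x $ i * ?D j (?g i) x))
        + (\<Sum>j\<in>UNIV. c j * fam_op k (xi_deriv i (xi_deriv j a)) (?g i) x)"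
      by (simp add: quad_vf_def sum.distrib sum_distrib_left sum_distrib_right algebra_simps)
    also have "(\<Sum>j\<in>UNIV. B i j * ?D j (?g i) x) + (\<Sum>j\<in>UNIV. c j * x $ j) * ?D i (?g i) x
          + (\<Sum>j\<in>UNIV. c j * x $ i * ?D j (?g i) x) = (\<Sum>j\<in>UNIV. ?M x i j * ?D j (?g i) x)"
      by (simp add: quad_jac_def distrib_right sum.distrib if_distrib[of "\<lambda>u. u * _"] cong: if_cong)
    finally show ?thesis .
  qed
  have T: "?O (\<lambda>x. l * ?t x * f x) x = l * ?t x * ?O f x + l * (real CARD('m) + 1) * (\<Sum>j\<in>UNIV. c j * ?D j f x)"
  proof -
    have "(\<lambda>x. l * ?t x * f x) = (\<lambda>x. (l * (\<Sum>i\<in>UNIV. B i i)) * f x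
        + (l * (real CARD('m) + 1)) * (\<Sum>j\<in>UNIV. c j * (x $ j * f x)))"
      by (simp add: quad_trace_def algebra_simps sum_distrib_left sum_distrib_right)
    then have "?O (\<lambda>x. l * ?t x * f x) x = (l * (\<Sum>i\<in>UNIV. B i i)) * ?O f x
        + (l * (real CARD('m) + 1)) * (\<Sum>j\<in>UNIV. c j * ?O (\<lambda>x. x $ j * f x) x)"
      using f by (simp add: fam_op_add fam_op_sum fam_op_cmult Cinf_add Cinf_sum Cinf_mult)
    also have "\<dots> = l * ?t x * ?O f x + l * (real CARD('m) + 1) * (\<Sum>j\<in>UNIV. c j * ?D j f x)"
      by (simp only: fam_op_nth_mult[OF a f])
        (simp add: quad_trace_def sum.distrib sum_distrib_left sum_distrib_right algebra_simps)
    finally show ?thesis .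
  qed
  \<comment> \<open>The derivative in \<open>?g i\<close> supplies a factor \<xi>_i, and Euler's
    identity turns the sum over i into the degree left after the contraction.\<close>
  have E: "(\<Sum>i\<in>UNIV. \<Sum>j\<in>UNIV. c j * fam_op k (xi_deriv i (xi_deriv j a)) (?g i) x)
      = fam_op k (\<lambda>\<alpha> x. real (mi_abs \<alpha>) * fam_contract c a \<alpha> x) f x"
  proof -
    have e: "(\<Sum>i\<in>UNIV. fam_op k (xi_mult i (xi_deriv i (xi_deriv j a))) f x)
        = fam_op k (\<lambda>\<alpha> x. real (mi_abs \<alpha>) * xi_deriv j a \<alpha> x) f x" for j
      using fam_op_lincomb[of k "\<lambda>i x. 1" "\<lambda>i. xi_mult i (xi_deriv i (xi_deriv j a))" UNIV f x]
      by (simp add: xi_euler)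
    have "(\<Sum>i\<in>UNIV. \<Sum>j\<in>UNIV. c j * fam_op k (xi_deriv i (xi_deriv j a)) (?g i) x)
        = (\<Sum>j\<in>UNIV. c j * fam_op k (\<lambda>\<alpha> x. real (mi_abs \<alpha>) * xi_deriv j a \<alpha> x) f x)"
      using fam_op_partial[OF z2 f] by (subst sum.swap) (simp add: sum_distrib_left[symmetric] e)
    also have "\<dots> = fam_op k (\<lambda>\<alpha> x. real (mi_abs \<alpha>) * fam_contract c a \<alpha> x) f x"
      using fam_op_lincomb[of k "\<lambda>j x. c j" "\<lambda>j \<alpha> x. real (mi_abs \<alpha>) * xi_deriv j a \<alpha> x" UNIV f x]
      by (simp add: fam_contract_def sum_distrib_left mult.left_commute)
    finally show ?thesis .
  qed
  have C: "(\<Sum>j\<in>UNIV. c j * ?D j f x) = fam_op k (fam_contract c a) f x"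
    using fam_op_lincomb[of k "\<lambda>j x. c j" "\<lambda>j. xi_deriv j a" UNIV f x]
    by (simp add: fam_contract_def[abs_def])
  have G: "fam_op k (\<lambda>\<alpha> x. fam_gamma l c a \<alpha> x) f x
      = - fam_op k (\<lambda>\<alpha> x. real (mi_abs \<alpha>) * fam_contract c a \<alpha> x) f x
        - l * (real CARD('m) + 1) * (\<Sum>j\<in>UNIV. c j * ?D j f x)"
    unfolding C
    by (simp add: fam_op_def fam_gamma_def sum_distrib_left algebra_simps sum.distrib sum_negf sum_subtractf)
  have L: "fam_op k (\<lambda>\<alpha> x. fam_lie (mu - l) A B c a \<alpha> x) f x
      = (\<Sum>i\<in>UNIV. ?V x i * fam_op k (\<lambda>\<alpha>. partial i (a \<alpha>)) f x)
        - (\<Sum>i\<in>UNIV. \<Sum>j\<in>UNIV. ?M x i j * ?D j (?g i) x) + (mu - l) * ?t x * ?O f x"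
  proof -
    have 1: "(\<Sum>i\<in>UNIV. \<Sum>j\<in>UNIV. ?M x i j * ?D j (?g i) x)
      = fam_op k (\<lambda>\<alpha> x. \<Sum>i\<in>UNIV. \<Sum>j\<in>UNIV. ?M x i j * xi_mult i (xi_deriv j a) \<alpha> x) f x"
      using fam_op_lincomb[of k "\<lambda>i x. 1" "\<lambda>i \<alpha> x. \<Sum>j\<in>UNIV. ?M x i j * xi_mult i (xi_deriv j a) \<alpha> x" UNIV f x]
      by (simp add: fam_op_lincomb fam_op_partial[OF z f])
    have 2: "(\<Sum>i\<in>UNIV. ?V x i * fam_op k (\<lambda>\<alpha>. partial i (a \<alpha>)) f x)
      = fam_op k (\<lambda>\<alpha> x. \<Sum>i\<in>UNIV. ?V x i * partial i (a \<alpha>) x) f x"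
      by (simp add: fam_op_lincomb)
    show ?thesis
      unfolding 1 2 fam_lie_def
      by (simp add: fam_op_def algebra_simps sum.distrib sum_subtractf sum_distrib_left)
  qed
  have split: "?O (\<lambda>x. (\<Sum>i\<in>UNIV. ?V x i * ?g i x) + l * ?t x * f x) x
      = (\<Sum>i\<in>UNIV. ?O (\<lambda>x. ?V x i * ?g i x) x) + ?O (\<lambda>x. l * ?t x * f x) x"
    using f g by (simp add: fam_op_add fam_op_sum Cinf_sum Cinf_mult)
  have "fam_op k (\<lambda>\<alpha> x. fam_lie (mu - l) A B c a \<alpha> x + fam_gamma l c a \<alpha> x) f x
      = fam_op k (\<lambda>\<alpha> x. fam_lie (mu - l) A B c a \<alpha> x) f x + fam_op k (\<lambda>\<alpha> x. fam_gamma l c a \<alpha> x) f x"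
    by (simp add: fam_op_def algebra_simps sum.distrib)
  then show ?thesis
    unfolding split V T L G partial_fam_op[OF smooth f] E[symmetric]
    by (simp add: algebra_simps sum.distrib)
qed

section \<open>Symbols and operators as modules\<close>

lemma jacobian_nth:
  fixes X :: "real^'m \<Rightarrow> real^'m"
  assumes "X differentiable (at x)"
  shows "jacobian X (at x) $ i $ j = partial j (\<lambda>y. X y $ i) x"
proof -
  have "(X has_derivative frechet_derivative X (at x)) (at x)"
    using assms by (simp add: frechet_derivative_works)
  from partial_eqI[OF bounded_linear.has_derivative[OF bounded_linear_vec_nth this], of j i]
  show ?thesis by (simp add: jacobian_def matrix_def)
qed

definition quad_field :: "('m \<Rightarrow> real) \<Rightarrow> ('m \<Rightarrow> 'm \<Rightarrow> real) \<Rightarrow> ('m \<Rightarrow> real) \<Rightarrow> real^'m \<Rightarrow> real^'m"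
  where "quad_field A B c = (\<lambda>x. (\<Sum>i\<in>UNIV. A i *\<^sub>R axis i 1)
    + (\<Sum>i\<in>UNIV. \<Sum>j\<in>UNIV. B i j *\<^sub>R (x $ j *\<^sub>R axis i 1))
    + (\<Sum>j\<in>UNIV. c j *\<^sub>R (x $ j *\<^sub>R x)))"

lemma sl_proj_iff: "X \<in> sl_proj \<longleftrightarrow> (\<exists>A B c. X = quad_field A B c)"
  by (simp add: sl_proj_def quad_field_def)

lemma quad_field_nth:
  fixes A :: "'m::finite \<Rightarrow> real"
  shows "quad_field A B c x $ i = quad_vf A B c x i"
proof -
  have 1: "(\<Sum>i'\<in>UNIV. A i' *\<^sub>R axis i' 1 :: real^'m) $ i = A i" for A
    by (simp add: axis_def if_distrib[of "\<lambda>u. _ * u"] cong: if_cong)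
  have 2: "(\<Sum>i'\<in>UNIV. \<Sum>j\<in>UNIV. B i' j *\<^sub>R (x $ j *\<^sub>R axis i' 1)) $ i = (\<Sum>j\<in>UNIV. B i j * x $ j)"
    using 1[of "\<lambda>i. \<Sum>j\<in>UNIV. B i j * x $ j"] by (simp add: scaleR_sum_left)
  show ?thesis
    unfolding quad_field_def vector_add_component 1 2
    by (simp add: quad_vf_def sum_distrib_right mult.assoc)
qed

lemma quad_field_differentiable: "quad_field A B c differentiable (at x)"
  unfolding quad_field_def
  by (intro differentiable_add differentiable_sum differentiable_scaleR differentiable_nth
      differentiable_const differentiable_ident finite ballI)

lemma jacobian_quad_field: "jacobian (quad_field A B c) (at x) $ i $ j = quad_jac B c x i j"
  by (simp add: jacobian_nth quad_field_differentiable quad_field_nth partial_quad_vf)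

lemma trace_quad_field: "trace (jacobian (quad_field A B c) (at x)) = quad_trace B c x"
proof -
  have "trace (jacobian (quad_field A B c) (at x)) = (\<Sum>i\<in>UNIV. quad_jac B c x i i)"
    by (simp add: trace_def jacobian_quad_field)
  also have "\<dots> = quad_trace B c x"
    by (simp add: quad_jac_def quad_trace_def sum.distrib algebra_simps)
  finally show ?thesis .
qed

lemma lie_dens_quad_field:
  "lie_dens l (quad_field A B c) f = (\<lambda>x. (\<Sum>i\<in>UNIV. quad_vf A B c x i * partial i f x) + l * quad_trace B c x * f x)"
  by (simp add: lie_dens_def quad_field_nth trace_quad_field)

lemma lie_dens_Cinf: "f \<in> Cinf \<Longrightarrow> lie_dens l (quad_field A B c) f \<in> Cinf"
  unfolding lie_dens_quad_field
  by (intro Cinf_add Cinf_sum Cinf_mult quad_vf_Cinf quad_trace_Cinf Cinf_const Cinf_partial)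

lemma finite_mi_abs_eq: "finite {\<alpha> :: 'm::finite \<Rightarrow> nat. mi_abs \<alpha> = k}"
  by (rule finite_subset[OF _ finite_mi_abs_le[of k]]) auto

lemma mi_power_inc: "mi_power \<xi> (mi_inc i \<alpha>) = \<xi> $ i * mi_power \<xi> \<alpha>"
proof -
  have "(\<Prod>j\<in>UNIV - {i}. (\<xi> $ j) ^ mi_inc i \<alpha> j) = (\<Prod>j\<in>UNIV - {i}. (\<xi> $ j) ^ \<alpha> j)"
    by (rule prod.cong) (auto simp: mi_inc_apply)
  then show ?thesis
    unfolding mi_power_def by (subst (1 2) prod.remove[of _ i]) auto
qed

lemma mi_power_Cinf: "(\<lambda>\<xi>::real^'m. mi_power \<xi> \<alpha>) \<in> Cinf"
  using Cinf_mi_power[of 0 \<alpha>] by simp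

lemma symb_of_Cinf: "symb_of k a x \<in> Cinf"
proof -
  have "(\<lambda>\<xi>. \<Sum>\<alpha> | mi_abs \<alpha> = k. a \<alpha> x * mi_power \<xi> \<alpha>) \<in> Cinf"
    by (intro Cinf_sum Cinf_mult Cinf_const mi_power_Cinf)
  then show ?thesis by (simp add: symb_of_def)
qed

text \<open>Multiplication and derivative are taken together because only their combination stays in
  degree k.\<close>

lemma symb_of_xi_mult_deriv:
  "\<xi> $ i * partial j (symb_of k a x) \<xi> = symb_of k (xi_mult i (xi_deriv j a)) x \<xi>"
proof -
  have p: "partial j (\<lambda>\<xi>. mi_power \<xi> \<alpha>) \<xi> = real (\<alpha> j) * mi_power \<xi> (mi_dec j \<alpha>)" for \<alpha>
    using fun_cong[OF partial_mi_power[of j 0 \<alpha>], of \<xi>] by simp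
  have "partial j (symb_of k a x) \<xi> = (\<Sum>\<alpha> | mi_abs \<alpha> = k. partial j (\<lambda>\<xi>. a \<alpha> x * mi_power \<xi> \<alpha>) \<xi>)"
    unfolding symb_of_def
    by (rule partial_sum) (intro Cinf_differentiable Cinf_mult Cinf_const mi_power_Cinf)
  also have "\<dots> = (\<Sum>\<alpha> | mi_abs \<alpha> = k. a \<alpha> x * (real (\<alpha> j) * mi_power \<xi> (mi_dec j \<alpha>)))"
    by (simp add: partial_cmult Cinf_differentiable mi_power_Cinf p)
  finally have "\<xi> $ i * partial j (symb_of k a x) \<xi>
      = (\<Sum>\<alpha> | mi_abs \<alpha> = k. a \<alpha> x * (real (\<alpha> j) * mi_power \<xi> (mi_inc i (mi_dec j \<alpha>))))"
    by (simp add: sum_distrib_left mi_power_inc mult_ac)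
  also have "\<dots> = (\<Sum>\<alpha> | mi_abs \<alpha> = k \<and> \<alpha> j \<noteq> 0. a \<alpha> x * (real (\<alpha> j) * mi_power \<xi> (mi_inc i (mi_dec j \<alpha>))))"
    by (rule sum.mono_neutral_right) (auto simp: finite_mi_abs_eq)
  \<comment> \<open>Moving one unit from j to i matches the indices with positive j-entry to those
    with positive i-entry; all other terms are zero.\<close>
  also have "\<dots> = (\<Sum>\<beta> | mi_abs \<beta> = k \<and> \<beta> i \<noteq> 0. xi_mult i (xi_deriv j a) \<beta> x * mi_power \<xi> \<beta>)"
    by (rule sum.reindex_bij_witness[of _ "\<lambda>\<beta>. mi_inc j (mi_dec i \<beta>)" "\<lambda>\<alpha>. mi_inc i (mi_dec j \<alpha>)"])
      (auto simp: mi_abs_dec xi_mult_def xi_deriv_def mi_dec_apply)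
  also have "\<dots> = (\<Sum>\<beta> | mi_abs \<beta> = k. xi_mult i (xi_deriv j a) \<beta> x * mi_power \<xi> \<beta>)"
    by (rule sum.mono_neutral_left) (auto simp: finite_mi_abs_eq xi_mult_def)
  finally show ?thesis by (simp add: symb_of_def)
qed

lemma symb_of_lincomb:
  "symb_of k (\<lambda>\<alpha> x. \<Sum>i\<in>I. h i x * b i \<alpha> x) x \<xi> = (\<Sum>i\<in>I. h i x * symb_of k (b i) x \<xi>)"
  unfolding symb_of_def sum_distrib_right sum_distrib_left
  by (subst sum.swap) (simp add: mult_ac)

lemma lie_symb_symb_of:
  fixes a :: "('m::finite \<Rightarrow> nat) \<Rightarrow> real^'m \<Rightarrow> real"
  assumes smooth: "\<And>\<alpha>. a \<alpha> \<in> Cinf"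
  shows "lie_symb d (quad_field A B c) (symb_of k a) = symb_of k (fam_lie d A B c a)"
proof (intro ext)
  fix x \<xi> :: "real^'m"
  have "partial i (\<lambda>y. symb_of k a y \<xi>) x = (\<Sum>\<alpha> | mi_abs \<alpha> = k. partial i (\<lambda>y. a \<alpha> y * mi_power \<xi> \<alpha>) x)" for i
    unfolding symb_of_def
    by (rule partial_sum) (intro Cinf_differentiable Cinf_mult smooth Cinf_const)
  also have "\<dots> i = symb_of k (\<lambda>\<alpha>. partial i (a \<alpha>)) x \<xi>" for i
    by (simp add: partial_mult Cinf_differentiable smooth symb_of_def)
  finally have 1: "(\<Sum>i\<in>UNIV. quad_vf A B c x i * partial i (\<lambda>y. symb_of k a y \<xi>) x)
      = symb_of k (\<lambda>\<alpha> x. \<Sum>i\<in>UNIV. quad_vf A B c x i * partial i (a \<alpha>) x) x \<xi>"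
    by (simp add: symb_of_lincomb)
  have "gl_act (jacobian (quad_field A B c) (at x)) (symb_of k a x) \<xi>
      = (\<Sum>j\<in>UNIV. (transpose (jacobian (quad_field A B c) (at x)) *v \<xi>) $ j * partial j (symb_of k a x) \<xi>)"
    unfolding gl_act_def
    by (rule frechet_derivative_eq_sum_partial[OF Cinf_differentiable[OF symb_of_Cinf]])
  also have "\<dots> = (\<Sum>j\<in>UNIV. \<Sum>i\<in>UNIV. quad_jac B c x i j * (\<xi> $ i * partial j (symb_of k a x) \<xi>))"
    by (simp add: matrix_vector_mult_def transpose_def jacobian_quad_field sum_distrib_left mult_ac)
  also have "\<dots> = (\<Sum>i\<in>UNIV. \<Sum>j\<in>UNIV. quad_jac B c x i j * symb_of k (xi_mult i (xi_deriv j a)) x \<xi>)"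
    unfolding symb_of_xi_mult_deriv by (rule sum.swap)
  also have "\<dots> = symb_of k (\<lambda>\<alpha> x. \<Sum>i\<in>UNIV. \<Sum>j\<in>UNIV. quad_jac B c x i j * xi_mult i (xi_deriv j a) \<alpha> x) x \<xi>"
    using symb_of_lincomb[of k "\<lambda>i x. 1" "\<lambda>i \<alpha> x. \<Sum>j\<in>UNIV. quad_jac B c x i j * xi_mult i (xi_deriv j a) \<alpha> x" UNIV x \<xi>]
    by (simp add: symb_of_lincomb)
  finally have 2: "gl_act (jacobian (quad_field A B c) (at x)) (symb_of k a x) \<xi>
      = symb_of k (\<lambda>\<alpha> x. \<Sum>i\<in>UNIV. \<Sum>j\<in>UNIV. quad_jac B c x i j * xi_mult i (xi_deriv j a) \<alpha> x) x \<xi>" .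
  show "lie_symb d (quad_field A B c) (symb_of k a) x \<xi> = symb_of k (fam_lie d A B c a) x \<xi>"
    unfolding lie_symb_def quad_field_nth trace_quad_field 1 2 fam_lie_def
    by (simp add: symb_of_def algebra_simps sum.distrib sum_subtractf sum_distrib_left)
qed

section \<open>Recovering the coefficients of operators and symbols\<close>

lemma fam_op_mi_power:
  assumes "mi_abs \<alpha> \<le> k"
  shows "fam_op k a (\<lambda>y. mi_power (y - x) \<alpha>) x = a \<alpha> x * mi_fact \<alpha>"
  using assms
  by (simp add: fam_op_def mi_partial_mi_power if_distrib[of "\<lambda>u. _ * u"] finite_mi_abs_le cong: if_cong)

text \<open>Testing on monomials centred at x isolates each coefficient at x. The description in
  \<open>principal_symbol\<close> is well defined because of this.\<close>

lemma diff_op_inject: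
  fixes a b :: "('m::finite \<Rightarrow> nat) \<Rightarrow> real^'m \<Rightarrow> real"
  assumes "diff_op k a = diff_op k b" "mi_abs \<alpha> \<le> k"
  shows "a \<alpha> = b \<alpha>"
proof
  fix x
  have "diff_op k a (\<lambda>y. mi_power (y - x) \<alpha>) x = diff_op k b (\<lambda>y. mi_power (y - x) \<alpha>) x"
    using assms(1) by simp
  then show "a \<alpha> x = b \<alpha> x"
    using assms(2) by (simp add: diff_op_eq Cinf_mi_power fam_op_mi_power)
qed

lemma diff_op_cong: "(\<And>\<alpha>. mi_abs \<alpha> \<le> k \<Longrightarrow> a \<alpha> = b \<alpha>) \<Longrightarrow> diff_op k a = diff_op k b"
  by (simp add: diff_op_def)

lemma symb_of_cong: "(\<And>\<alpha>. mi_abs \<alpha> = k \<Longrightarrow> a \<alpha> = b \<alpha>) \<Longrightarrow> symb_of k a = symb_of k b"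
  by (simp add: symb_of_def)

lemma principal_symbol_diff_op:
  fixes a :: "('m::finite \<Rightarrow> nat) \<Rightarrow> real^'m \<Rightarrow> real"
  assumes "\<And>\<alpha>. a \<alpha> \<in> Cinf"
  shows "principal_symbol k (diff_op k a) = symb_of k a"
  unfolding principal_symbol_def
proof (rule the_equality)
  show "\<exists>b. (\<forall>\<alpha>. b \<alpha> \<in> Cinf) \<and> diff_op k a = diff_op k b \<and> symb_of k a = symb_of k b"
    using assms by blast
next
  fix P
  assume "\<exists>b. (\<forall>\<alpha>. b \<alpha> \<in> Cinf) \<and> diff_op k a = diff_op k b \<and> P = symb_of k b"
  then obtain b where b: "diff_op k a = diff_op k b" "P = symb_of k b" by blast
  show "P = symb_of k a"
    unfolding b(2) by (rule symb_of_cong) (metis diff_op_inject[OF b(1)] order_refl)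
qed

text \<open>Taylor coefficients at \<xi> = 0 depend on the symbol alone and not on a chosen
  representative, so a section can be defined through them.\<close>

definition symb_coeff :: "nat \<Rightarrow> (real^'m \<Rightarrow> real^'m \<Rightarrow> real) \<Rightarrow> ('m \<Rightarrow> nat) \<Rightarrow> real^'m \<Rightarrow> real"
  where "symb_coeff k P \<alpha> = (if mi_abs \<alpha> = k then (\<lambda>x. mi_partial \<alpha> (P x) 0 / mi_fact \<alpha>) else (\<lambda>_. 0))"

lemma symb_coeff_symb_of:
  "symb_coeff k (symb_of k a) = (\<lambda>\<alpha>. if mi_abs \<alpha> = k then a \<alpha> else (\<lambda>_. 0))"
proof (intro ext)
  fix \<alpha> :: "'a \<Rightarrow> nat" and x
  show "symb_coeff k (symb_of k a) \<alpha> x = (if mi_abs \<alpha> = k then a \<alpha> else (\<lambda>_. 0)) x"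
  proof (cases "mi_abs \<alpha> = k")
    case True
    have lin: "mi_partial \<alpha> (\<lambda>\<xi>. \<Sum>\<beta>\<in>S. a \<beta> x * mi_power \<xi> \<beta>) 0
        = (\<Sum>\<beta>\<in>S. a \<beta> x * (if \<alpha> = \<beta> then mi_fact \<beta> else 0))" if "finite S" for S
      using that
    proof induction
      case empty
      show ?case using mi_partial_cmult[of "\<lambda>_. 0" \<alpha> 0] by simp
    next
      case (insert \<beta> S)
      have "(\<lambda>\<xi>. \<Sum>\<beta>\<in>S. a \<beta> x * mi_power \<xi> \<beta>) \<in> Cinf"
        by (intro Cinf_sum Cinf_mult Cinf_const mi_power_Cinf)
      then show ?case
        using insert mi_partial_mi_power[of \<alpha> 0 \<beta>]
        by (simp add: mi_partial_add mi_partial_cmult Cinf_mult mi_power_Cinf)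
    qed
    show ?thesis
      using True
      by (simp add: symb_coeff_def symb_of_def lin[OF finite_mi_abs_eq] finite_mi_abs_eq
          if_distrib[of "\<lambda>u. _ * u"] cong: if_cong)
  qed (simp add: symb_coeff_def)
qed

text \<open>\<open>diff_op k\<close> ignores coefficients of degree above k, so the representative
  may be truncated; the commutator lemmas for \<open>fam_op\<close> ask for exactly this.\<close>

lemma diff_op_carrier_cases:
  fixes A :: "(real^'m \<Rightarrow> real) \<Rightarrow> real^'m \<Rightarrow> real"
  assumes "A \<in> mcarrier (diff_op_module k l u)"
  obtains a where "\<And>\<alpha>. a \<alpha> \<in> Cinf" "\<And>\<alpha>. mi_abs \<alpha> > k \<Longrightarrow> a \<alpha> = (\<lambda>_. 0)" "A = diff_op k a"
proof -
  obtain b where b: "\<And>\<alpha>. b \<alpha> \<in> Cinf" "A = diff_op k b"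
    using assms by (auto simp: diff_op_module_def)
  show ?thesis
  proof (rule that)
    show "A = diff_op k (\<lambda>\<alpha>. if mi_abs \<alpha> \<le> k then b \<alpha> else (\<lambda>_. 0))"
      unfolding b by (rule diff_op_cong) simp
  qed (auto simp: b)
qed

lemma symbol_carrier_cases:
  fixes P :: "real^'m \<Rightarrow> real^'m \<Rightarrow> real"
  assumes "P \<in> mcarrier (symbol_module k d)"
  obtains a where "\<And>\<alpha>. a \<alpha> \<in> Cinf" "\<And>\<alpha>. mi_abs \<alpha> \<noteq> k \<Longrightarrow> a \<alpha> = (\<lambda>_. 0)" "P = symb_of k a"
proof -
  obtain b where b: "\<And>\<alpha>. b \<alpha> \<in> Cinf" "P = symb_of k b"
    using assms by (auto simp: symbol_module_def)
  show ?thesis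
  proof (rule that)
    show "P = symb_of k (\<lambda>\<alpha>. if mi_abs \<alpha> = k then b \<alpha> else (\<lambda>_. 0))"
      unfolding b by (rule symb_of_cong) simp
  qed (auto simp: b)
qed

section \<open>Module operations on representing families\<close>

lemma diff_op_carrierI: "(\<And>\<alpha>. a \<alpha> \<in> Cinf) \<Longrightarrow> diff_op k a \<in> mcarrier (diff_op_module k l u)"
  by (auto simp: diff_op_module_def)

lemma symbol_carrierI: "(\<And>\<alpha>. a \<alpha> \<in> Cinf) \<Longrightarrow> symb_of k a \<in> mcarrier (symbol_module k d)"
  by (auto simp: symbol_module_def)

lemma diff_op_madd:
  "madd (diff_op_module k l u) (diff_op k a) (diff_op k b) = diff_op k (\<lambda>\<alpha> x. a \<alpha> x + b \<alpha> x)"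
  by (simp add: diff_op_module_def diff_op_eq fam_op_def fun_eq_iff restrict_def distrib_right sum.distrib)

lemma diff_op_mscale:
  "mscale (diff_op_module k l u) r (diff_op k a) = diff_op k (\<lambda>\<alpha> x. r * a \<alpha> x)"
  by (simp add: diff_op_module_def diff_op_eq fam_op_def fun_eq_iff restrict_def sum_distrib_left mult.assoc)

lemma symbol_madd:
  "madd (symbol_module k d) (symb_of k a) (symb_of k b) = symb_of k (\<lambda>\<alpha> x. a \<alpha> x + b \<alpha> x)"
  by (simp add: symbol_module_def symb_of_def fun_eq_iff distrib_right sum.distrib)

lemma symbol_mscale:
  "mscale (symbol_module k d) r (symb_of k a) = symb_of k (\<lambda>\<alpha> x. r * a \<alpha> x)"
  by (simp add: symbol_module_def symb_of_def fun_eq_iff sum_distrib_left mult.assoc)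

lemma symbol_mact:
  fixes a :: "('m::finite \<Rightarrow> nat) \<Rightarrow> real^'m \<Rightarrow> real"
  assumes "\<And>\<alpha>. a \<alpha> \<in> Cinf"
  shows "mact (symbol_module k d) (quad_field A B c) (symb_of k a) = symb_of k (fam_lie d A B c a)"
  using lie_symb_symb_of[OF assms] by (simp add: symbol_module_def)

lemma diff_op_mact:
  fixes a :: "('m::finite \<Rightarrow> nat) \<Rightarrow> real^'m \<Rightarrow> real"
  assumes "\<And>\<alpha>. a \<alpha> \<in> Cinf" "\<And>\<alpha>. mi_abs \<alpha> > k \<Longrightarrow> a \<alpha> = (\<lambda>_. 0)"
  shows "mact (diff_op_module k l u) (quad_field A B c) (diff_op k a)
    = diff_op k (\<lambda>\<alpha> x. fam_lie (u - l) A B c a \<alpha> x + fam_gamma l c a \<alpha> x)"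
proof
  fix f
  show "mact (diff_op_module k l u) (quad_field A B c) (diff_op k a) f
    = diff_op k (\<lambda>\<alpha> x. fam_lie (u - l) A B c a \<alpha> x + fam_gamma l c a \<alpha> x) f"
  proof (cases "f \<in> Cinf")
    case True
    have "lie_dens u (quad_field A B c) (fam_op k a f) x - fam_op k a (lie_dens l (quad_field A B c) f) x
        = fam_op k (\<lambda>\<alpha> x. fam_lie (u - l) A B c a \<alpha> x + fam_gamma l c a \<alpha> x) f x" for x
      using fam_op_lie[where k = k and A = A and B = B and c = c and x = x and mu = u and l = l, OF assms True] by (simp add: lie_dens_quad_field)
    with True show ?thesis
      by (simp add: diff_op_module_def diff_op_eq lie_dens_Cinf fun_eq_iff)
  qed (simp add: diff_op_module_def diff_op_def)
qed

lemma fam_gamma_Cinf: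
  fixes a :: "('m::finite \<Rightarrow> nat) \<Rightarrow> real^'m \<Rightarrow> real"
  assumes "\<And>\<alpha>. a \<alpha> \<in> Cinf"
  shows "fam_gamma l c a \<alpha> \<in> Cinf"
  unfolding fam_gamma_def by (intro Cinf_minus Cinf_mult Cinf_const fam_contract_Cinf assms)

text \<open>The defect lowers the degree by one, so the top degree does not see it. This is why the
  symbol map is equivariant although operators carry the extra term.\<close>

lemma fam_gamma_top:
  assumes "\<And>\<alpha>. mi_abs \<alpha> > k \<Longrightarrow> a \<alpha> = (\<lambda>_. 0)" "mi_abs \<alpha> \<ge> k"
  shows "fam_gamma l c a \<alpha> x = 0"
proof -
  have "fam_contract c a \<alpha> x = 0 * fam_contract c a \<alpha> x"
    by (rule fam_contract_scale) (use assms in auto)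
  then show ?thesis by (simp add: fam_gamma_def)
qed

section \<open>Exactness of the symbol sequence\<close>

lemma short_exact_diff_op:
  assumes k: "k \<ge> 1" and d: "d = u - l"
  shows "short_exact (sl_proj :: (real^'m \<Rightarrow> real^'m) set) (diff_op_module (k - 1) l u) (\<lambda>A. A)
    (diff_op_module k l u) (principal_symbol k) (symbol_module k d)"
proof -
  \<comment> \<open>An operator of order at most k - 1 is the same function as the order k operator
    with empty top degree, so the identity can serve as the inclusion.\<close>
  have incl: "diff_op (k - 1) a = diff_op k a"
    if "\<And>\<alpha>. mi_abs \<alpha> > k - 1 \<Longrightarrow> a \<alpha> = (\<lambda>_. 0)" for a :: "('m \<Rightarrow> nat) \<Rightarrow> real^'m \<Rightarrow> real"
  proof -
    have "(\<Sum>\<alpha> | mi_abs \<alpha> \<le> k - 1. a \<alpha> x * mi_partial \<alpha> f x) = (\<Sum>\<alpha> | mi_abs \<alpha> \<le> k. a \<alpha> x * mi_partial \<alpha> f x)" for f x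
      by (rule sum.mono_neutral_left) (use that in \<open>auto simp: finite_mi_abs_le\<close>)
    then show ?thesis by (simp add: diff_op_def)
  qed
  have sub: "A \<in> mcarrier (diff_op_module k l u)" if "A \<in> mcarrier (diff_op_module (k - 1) l u)"
    for A :: "(real^'m \<Rightarrow> real) \<Rightarrow> real^'m \<Rightarrow> real"
    using that
  proof (rule diff_op_carrier_cases)
    fix a :: "('m \<Rightarrow> nat) \<Rightarrow> real^'m \<Rightarrow> real"
    assume a: "\<And>\<alpha>. a \<alpha> \<in> Cinf" "\<And>\<alpha>. mi_abs \<alpha> > k - 1 \<Longrightarrow> a \<alpha> = (\<lambda>_. 0)" "A = diff_op (k - 1) a"
    have "A = diff_op k a"
      using a(3) incl[of a] a(2) by metis
    then show ?thesis
      using a(1) by (simp add: diff_op_carrierI)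
  qed
  have hom1: "module_hom_on (sl_proj :: (real^'m \<Rightarrow> real^'m) set) (diff_op_module (k - 1) l u)
      (diff_op_module k l u) (\<lambda>A. A)"
    using sub unfolding module_hom_on_def by (auto simp: diff_op_module_def)
  have hom2: "module_hom_on (sl_proj :: (real^'m \<Rightarrow> real^'m) set) (diff_op_module k l u)
      (symbol_module k d) (principal_symbol k)"
    unfolding module_hom_on_def
  proof (intro conjI ballI allI funcsetI)
    fix A B :: "(real^'m \<Rightarrow> real) \<Rightarrow> real^'m \<Rightarrow> real"
    assume A: "A \<in> mcarrier (diff_op_module k l u)" and B: "B \<in> mcarrier (diff_op_module k l u)"
    obtain a where a: "\<And>\<alpha>. a \<alpha> \<in> Cinf" "\<And>\<alpha>. mi_abs \<alpha> > k \<Longrightarrow> a \<alpha> = (\<lambda>_. 0)" "A = diff_op k a"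
      using A by (rule diff_op_carrier_cases) blast
    obtain b where b: "\<And>\<alpha>. b \<alpha> \<in> Cinf" "\<And>\<alpha>. mi_abs \<alpha> > k \<Longrightarrow> b \<alpha> = (\<lambda>_. 0)" "B = diff_op k b"
      using B by (rule diff_op_carrier_cases) blast
    show "principal_symbol k (madd (diff_op_module k l u) A B)
        = madd (symbol_module k d) (principal_symbol k A) (principal_symbol k B)"
      unfolding a(3) b(3) diff_op_madd
      using a(1) b(1) by (simp add: principal_symbol_diff_op symbol_madd Cinf_add)
  next
    fix A :: "(real^'m \<Rightarrow> real) \<Rightarrow> real^'m \<Rightarrow> real"
    assume A: "A \<in> mcarrier (diff_op_module k l u)"
    obtain a where a: "\<And>\<alpha>. a \<alpha> \<in> Cinf" "\<And>\<alpha>. mi_abs \<alpha> > k \<Longrightarrow> a \<alpha> = (\<lambda>_. 0)" "A = diff_op k a"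
      using A by (rule diff_op_carrier_cases) blast
    show "principal_symbol k A \<in> mcarrier (symbol_module k d)"
      using a(1) by (simp add: a(3) principal_symbol_diff_op symbol_carrierI)
    show "principal_symbol k (mscale (diff_op_module k l u) r A)
        = mscale (symbol_module k d) r (principal_symbol k A)" for r
      unfolding a(3) diff_op_mscale
      using a(1) by (simp add: principal_symbol_diff_op symbol_mscale Cinf_mult)
    fix X :: "real^'m \<Rightarrow> real^'m"
    assume "X \<in> sl_proj"
    then obtain A' B' c' where X: "X = quad_field A' B' c'" by (auto simp: sl_proj_iff)
    have "symb_of k (\<lambda>\<alpha> x. fam_lie (u - l) A' B' c' a \<alpha> x + fam_gamma l c' a \<alpha> x)
        = symb_of k (fam_lie d A' B' c' a)"
      by (rule symb_of_cong) (simp add: fam_gamma_top[OF a(2)] d)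
    moreover have "mact (diff_op_module k l u) X A
        = diff_op k (\<lambda>\<alpha> x. fam_lie (u - l) A' B' c' a \<alpha> x + fam_gamma l c' a \<alpha> x)"
      unfolding a(3) X by (rule diff_op_mact) (use a in auto)
    ultimately show "principal_symbol k (mact (diff_op_module k l u) X A)
        = mact (symbol_module k d) X (principal_symbol k A)"
      unfolding a(3) X using a(1) by (simp add: principal_symbol_diff_op symbol_mact Cinf_add fam_lie_Cinf fam_gamma_Cinf)
  qed
  have ker: "A \<in> mcarrier (diff_op_module (k - 1) l u) \<longleftrightarrow>
      A \<in> mcarrier (diff_op_module k l u) \<and> principal_symbol k A = (\<lambda>x \<xi>. 0)"
    for A :: "(real^'m \<Rightarrow> real) \<Rightarrow> real^'m \<Rightarrow> real"
  proof
    assume A: "A \<in> mcarrier (diff_op_module (k - 1) l u)"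
    then obtain a where a: "\<And>\<alpha>. a \<alpha> \<in> Cinf" "\<And>\<alpha>. mi_abs \<alpha> > k - 1 \<Longrightarrow> a \<alpha> = (\<lambda>_. 0)" "A = diff_op (k - 1) a"
      by (rule diff_op_carrier_cases) blast
    have "A = diff_op k a"
      using a(3) incl[of a] a(2) by metis
    then have "principal_symbol k A = symb_of k a"
      using a(1) by (simp add: principal_symbol_diff_op)
    \<comment> \<open>Here k \<ge> 1 matters: degree k lies above k - 1 only when the subtraction is
      not truncated.\<close>
    also have "\<dots> = (\<lambda>x \<xi>. 0)"
      using a(2) k by (simp add: symb_of_def)
    finally show "A \<in> mcarrier (diff_op_module k l u) \<and> principal_symbol k A = (\<lambda>x \<xi>. 0)"
      using sub[OF A] by simp
  next
    assume A: "A \<in> mcarrier (diff_op_module k l u) \<and> principal_symbol k A = (\<lambda>x \<xi>. 0)"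
    then have "A \<in> mcarrier (diff_op_module k l u)" ..
    then obtain a where a: "\<And>\<alpha>. a \<alpha> \<in> Cinf" "\<And>\<alpha>. mi_abs \<alpha> > k \<Longrightarrow> a \<alpha> = (\<lambda>_. 0)" "A = diff_op k a"
      by (rule diff_op_carrier_cases) blast
    have "symb_of k a = symb_of k (\<lambda>_ _. 0)"
      using A a(1) by (simp add: a(3) principal_symbol_diff_op) (simp add: symb_of_def)
    then have "symb_coeff k (symb_of k a) = symb_coeff k (symb_of k (\<lambda>_ _. 0))" by simp
    then have top: "a \<alpha> = (\<lambda>_. 0)" if "mi_abs \<alpha> = k" for \<alpha>
      unfolding symb_coeff_symb_of using that by (auto dest: fun_cong[of _ _ \<alpha>])
    have "a \<alpha> = (\<lambda>_. 0)" if "mi_abs \<alpha> > k - 1" for \<alpha>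
      using a(2)[of \<alpha>] top[of \<alpha>] that by (cases "mi_abs \<alpha> = k") auto
    then have "A = diff_op (k - 1) a"
      unfolding a(3) by (rule incl[symmetric])
    then show "A \<in> mcarrier (diff_op_module (k - 1) l u)"
      using a(1) by (simp add: diff_op_carrierI)
  qed
  have surj: "principal_symbol k ` mcarrier (diff_op_module k l u) = mcarrier (symbol_module k d :: (real^'m \<Rightarrow> real^'m, _) module_data)"
  proof (intro equalityI subsetI)
    fix P :: "real^'m \<Rightarrow> real^'m \<Rightarrow> real"
    assume "P \<in> mcarrier (symbol_module k d)"
    then obtain a where a: "\<And>\<alpha>. a \<alpha> \<in> Cinf" "P = symb_of k a"
      by (rule symbol_carrier_cases) blast
    then have "P = principal_symbol k (diff_op k a)"
      by (simp add: principal_symbol_diff_op)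
    then show "P \<in> principal_symbol k ` mcarrier (diff_op_module k l u)"
      using a(1) by (blast intro: diff_op_carrierI)
  next
    fix P :: "real^'m \<Rightarrow> real^'m \<Rightarrow> real"
    assume "P \<in> principal_symbol k ` mcarrier (diff_op_module k l u)"
    with hom2 show "P \<in> mcarrier (symbol_module k d)"
      by (auto simp: module_hom_on_def)
  qed
  have zero: "mzero (symbol_module k d) = (\<lambda>x \<xi>. 0)" by (simp add: symbol_module_def)
  show ?thesis
    unfolding short_exact_def zero using hom1 hom2 ker surj by (auto simp: inj_on_def)
qed

section \<open>Solving the recursion and building the section\<close>

lemma recursion_solvable:
  fixes p q :: "nat \<Rightarrow> real"
  assumes "\<And>n. 1 \<le> n \<Longrightarrow> n \<le> k \<Longrightarrow> q n = 0 \<Longrightarrow> \<exists>i\<in>{1..n}. p i = 0"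
  shows "\<exists>w. w 0 = 1 \<and> (\<forall>j. 1 \<le> j \<longrightarrow> j \<le> k \<longrightarrow> w j * q j = - (p j * w (j - 1)))"
proof -
  \<comment> \<open>Division by zero makes \<open>w\<close> vanish at a resonance; the hypothesis makes this consistent.\<close>
  define w where "w = rec_nat 1 (\<lambda>j r. - (p (Suc j) * r) / q (Suc j))"
  have w: "w 0 = 1" "w (Suc j) = - (p (Suc j) * w j) / q (Suc j)" for j
    by (simp_all add: w_def)
  have vanish: "w j = 0" if "i \<le> j" "1 \<le> i" "p i = 0" for i j
    using that
  proof (induction j)
    case (Suc j)
    then show ?case by (cases "i = Suc j") (auto simp: w)
  qed simp
  have "w j * q j = - (p j * w (j - 1))" if j: "1 \<le> j" "j \<le> k" for j
  proof (cases "q j = 0")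
    case True
    then obtain i where i: "1 \<le> i" "i \<le> j" "p i = 0" using assms[OF j] by auto
    then have "p j * w (j - 1) = 0" using vanish[of i "j - 1"] by (cases "i = j") auto
    with True show ?thesis by simp
  next
    case False
    with j show ?thesis by (cases j) (auto simp: w)
  qed
  with w(1) show ?thesis by blast
qed

lemma split_if_recursion:
  assumes k: "k \<ge> 1" and d: "d = u - l" and w0: "w 0 = 1"
    and w: "\<And>j. 1 \<le> j \<Longrightarrow> j \<le> k \<Longrightarrow>
      w j * real j * (d * (real CARD('m) + 1) - (real CARD('m) + 2 * real k - real j))
      = - ((real k - real j + l * (real CARD('m) + 1)) * w (j - 1))"
  shows "split_short_exact (sl_proj :: (real^'m \<Rightarrow> real^'m) set) (diff_op_module (k - 1) l u) (\<lambda>A. A)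
    (diff_op_module k l u) (principal_symbol k) (symbol_module k d)"
proof -
  define s where "s P = diff_op k (fam_lift k w (symb_coeff k P))" for P :: "real^'m \<Rightarrow> real^'m \<Rightarrow> real"
  have s: "s (symb_of k a) = diff_op k (fam_lift k w a)"
    if "\<And>\<alpha>. mi_abs \<alpha> \<noteq> k \<Longrightarrow> a \<alpha> = (\<lambda>_. 0)" for a :: "('m \<Rightarrow> nat) \<Rightarrow> real^'m \<Rightarrow> real"
  proof -
    have "symb_coeff k (symb_of k a) = a"
      using that by (auto simp: symb_coeff_symb_of fun_eq_iff)
    then show ?thesis by (simp add: s_def)
  qed
  have "module_hom_on (sl_proj :: (real^'m \<Rightarrow> real^'m) set) (symbol_module k d) (diff_op_module k l u) s"
    unfolding module_hom_on_def
  proof (intro conjI ballI allI funcsetI)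
    fix P Q :: "real^'m \<Rightarrow> real^'m \<Rightarrow> real"
    assume P: "P \<in> mcarrier (symbol_module k d)" and Q: "Q \<in> mcarrier (symbol_module k d)"
    obtain a where a: "\<And>\<alpha>. a \<alpha> \<in> Cinf" "\<And>\<alpha>. mi_abs \<alpha> \<noteq> k \<Longrightarrow> a \<alpha> = (\<lambda>_. 0)" "P = symb_of k a"
      using P by (rule symbol_carrier_cases) blast
    obtain b where b: "\<And>\<alpha>. b \<alpha> \<in> Cinf" "\<And>\<alpha>. mi_abs \<alpha> \<noteq> k \<Longrightarrow> b \<alpha> = (\<lambda>_. 0)" "Q = symb_of k b"
      using Q by (rule symbol_carrier_cases) blast
    have "fam_lift k w (\<lambda>\<alpha> x. a \<alpha> x + b \<alpha> x) = (\<lambda>\<alpha> x. fam_lift k w a \<alpha> x + fam_lift k w b \<alpha> x)"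
      by (auto simp: fam_lift_def funpow_div_add[OF a(1) b(1)] fun_eq_iff algebra_simps)
    then show "s (madd (symbol_module k d) P Q) = madd (diff_op_module k l u) (s P) (s Q)"
      unfolding a(3) b(3) symbol_madd using a(2) b(2) by (simp add: s diff_op_madd)
  next
    fix P :: "real^'m \<Rightarrow> real^'m \<Rightarrow> real"
    assume P: "P \<in> mcarrier (symbol_module k d)"
    obtain a where a: "\<And>\<alpha>. a \<alpha> \<in> Cinf" "\<And>\<alpha>. mi_abs \<alpha> \<noteq> k \<Longrightarrow> a \<alpha> = (\<lambda>_. 0)" "P = symb_of k a"
      using P by (rule symbol_carrier_cases) blast
    note lift = fam_lift_Cinf[OF a(1), of k w]
    have sP: "s P = diff_op k (fam_lift k w a)"
      unfolding a(3) by (rule s) (rule a(2))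
    show "s P \<in> mcarrier (diff_op_module k l u)"
      unfolding sP by (rule diff_op_carrierI[OF lift])
    have "fam_lift k w (\<lambda>\<alpha> x. r * a \<alpha> x) = (\<lambda>\<alpha> x. r * fam_lift k w a \<alpha> x)" for r
      by (auto simp: fam_lift_def funpow_div_cmult[OF a(1)] fun_eq_iff)
    then show "s (mscale (symbol_module k d) r P) = mscale (diff_op_module k l u) r (s P)" for r
      unfolding sP unfolding a(3) symbol_mscale using a(2) by (simp add: s diff_op_mscale)
    fix X :: "real^'m \<Rightarrow> real^'m"
    assume "X \<in> sl_proj"
    then obtain A B c where X: "X = quad_field A B c" by (auto simp: sl_proj_iff)
    \<comment> \<open>Away from degree k the family is zero, hence zero times itself; r = 0 in
      \<open>fam_lie_scale\<close> shows that the action keeps it so.\<close>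
    have "fam_lie d A B c a \<alpha> = (\<lambda>_. 0)" if "mi_abs \<alpha> \<noteq> k" for \<alpha>
      using fam_lie_scale[where a = a and b = a and r = 0 and \<alpha> = \<alpha> and d = d and A = A and B = B and c = c]
        a(1,2) that by (simp add: fun_eq_iff)
    then have "s (mact (symbol_module k d) X P) = diff_op k (fam_lift k w (fam_lie d A B c a))"
      unfolding a(3) X symbol_mact[OF a(1)] by (rule s)
    also have "\<dots> = diff_op k (\<lambda>\<alpha> x. fam_lie (u - l) A B c (fam_lift k w a) \<alpha> x
        + fam_gamma l c (fam_lift k w a) \<alpha> x)"
      unfolding d[symmetric] by (intro diff_op_cong ext fam_lift_equivariant a(1) w)
    also have "\<dots> = mact (diff_op_module k l u) X (s P)"
      unfolding sP X
      by (rule diff_op_mact[symmetric]) (use lift in \<open>auto simp: fam_lift_def\<close>)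
    finally show "s (mact (symbol_module k d) X P) = mact (diff_op_module k l u) X (s P)" .
  qed
  moreover have "principal_symbol k (s P) = P" if "P \<in> mcarrier (symbol_module k d)" for P
    using that
  proof (rule symbol_carrier_cases)
    fix a :: "('m \<Rightarrow> nat) \<Rightarrow> real^'m \<Rightarrow> real"
    assume a: "\<And>\<alpha>. a \<alpha> \<in> Cinf" "\<And>\<alpha>. mi_abs \<alpha> \<noteq> k \<Longrightarrow> a \<alpha> = (\<lambda>_. 0)" "P = symb_of k a"
    have "principal_symbol k (s P) = symb_of k (fam_lift k w a)"
      using a by (simp add: s principal_symbol_diff_op fam_lift_Cinf)
    \<comment> \<open>In the top degree the lift is multiplication by \<open>w 0\<close>.\<close>
    also have "\<dots> = symb_of k a"
      by (rule symb_of_cong) (simp add: fam_lift_def w0)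
    finally show ?thesis
      by (simp add: a(3))
  qed
  ultimately show ?thesis
    unfolding split_short_exact_def using short_exact_diff_op[OF k d] by blast
qed

section \<open>Obstruction to an equivariant section\<close>

lemma monomial_symbol:
  assumes "mi_abs \<beta> = k"
  shows "(\<lambda>x \<xi>. g x * mi_power \<xi> \<beta>) = symb_of k (\<lambda>\<alpha>. if \<alpha> = \<beta> then g else (\<lambda>_. 0))"
  using assms
  by (intro ext) (simp add: symb_of_def finite_mi_abs_eq if_distrib[of "\<lambda>u. u _"] if_distrib[of "\<lambda>u. u * _"]
      cong: if_cong)

lemma product_symbol_lie:
  fixes g p :: "real^'m \<Rightarrow> real"
  assumes g: "g \<in> Cinf" and p: "p \<in> Cinf"
  shows "lie_symb d (quad_field A B c) (\<lambda>x \<xi>. g x * p \<xi>) x \<xi> =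
      (\<Sum>i\<in>UNIV. quad_vf A B c x i * partial i g x) * p \<xi>
    - g x * (\<Sum>j\<in>UNIV. (\<Sum>i\<in>UNIV. quad_jac B c x i j * \<xi> $ i) * partial j p \<xi>)
    + d * quad_trace B c x * (g x * p \<xi>)"
proof -
  have 1: "partial i (\<lambda>y. g y * p \<xi>) x = partial i g x * p \<xi>" for i
    by (simp add: partial_mult Cinf_differentiable g)
  have "gl_act (jacobian (quad_field A B c) (at x)) (\<lambda>\<xi>. g x * p \<xi>) \<xi> =
      (\<Sum>j\<in>UNIV. (transpose (jacobian (quad_field A B c) (at x)) *v \<xi>) $ j * partial j (\<lambda>\<xi>. g x * p \<xi>) \<xi>)"
    unfolding gl_act_def
    by (rule frechet_derivative_eq_sum_partial[OF Cinf_differentiable[OF Cinf_mult[OF Cinf_const p]]])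
  also have "\<dots> = g x * (\<Sum>j\<in>UNIV. (\<Sum>i\<in>UNIV. quad_jac B c x i j * \<xi> $ i) * partial j p \<xi>)"
    by (simp add: matrix_vector_mult_def transpose_def jacobian_quad_field partial_cmult
        Cinf_differentiable p sum_distrib_left mult.left_commute)
  finally show ?thesis
    unfolding lie_symb_def quad_field_nth trace_quad_field 1 by (simp add: sum_distrib_right mult.assoc)
qed

definition axis_mi :: "'m \<Rightarrow> nat \<Rightarrow> 'm \<Rightarrow> nat"
  where "axis_mi o' k = (\<lambda>i. if i = o' then k else 0)"

lemma mi_abs_axis_mi [simp]: "mi_abs (axis_mi o' k) = k"
  by (simp add: mi_abs_def axis_mi_def)

lemma mi_power_axis_mi [simp]: "mi_power \<xi> (axis_mi o' k) = \<xi> $ o' ^ k"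
  by (simp add: mi_power_def axis_mi_def if_distrib[of "\<lambda>u. _ ^ u"] prod.delta cong: if_cong)

lemma partial_nth_power:
  "partial i (\<lambda>y::real^'m. y $ o' ^ n) x = (if i = o' then real n * x $ o' ^ (n - 1) else 0)"
  by (simp add: partial_power)

lemma lie_special_monomial:
  fixes o' :: "'m::finite"
  assumes j: "1 \<le> j"
  shows "lie_symb d (quad_field (\<lambda>_. 0) (\<lambda>_ _. 0) (\<lambda>i. if i = o' then 1 else 0))
      (\<lambda>x \<xi>. x $ o' ^ (j - 1) * \<xi> $ o' ^ k) x \<xi> =
      (real j - 1 + d * (real CARD('m) + 1) - 2 * real k) * (x $ o' ^ j * \<xi> $ o' ^ k)
      - (\<Sum>a\<in>UNIV - {o'}. real k * (x $ a * x $ o' ^ (j - 1) * (\<xi> $ a * \<xi> $ o' ^ (k - 1))))"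
proof -
  obtain n where n: "j = Suc n" using j by (cases j) auto
  let ?c = "\<lambda>i. if i = o' then 1 else 0 :: real"
  have lin: "(\<Sum>l\<in>UNIV. ?c l * x $ l) = x $ o'"
    by (simp add: if_distrib[of "\<lambda>u. u * _"] cong: if_cong)
  have V: "quad_vf (\<lambda>_. 0) (\<lambda>_ _. 0) ?c x i = x $ o' * x $ i" for i
    by (simp add: quad_vf_def lin)
  have M: "quad_jac (\<lambda>_ _. 0) ?c x i j = (if i = j then x $ o' else 0) + (if j = o' then x $ i else 0)" for i j
    by (simp add: quad_jac_def lin)
  have T: "quad_trace (\<lambda>_ _. 0) ?c x = (real CARD('m) + 1) * x $ o'"
    by (simp add: quad_trace_def lin)
  \<comment> \<open>Column \<open>o'\<close> of the Jacobian is x with its entry at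
    \<open>o'\<close> doubled; this is the origin of 2 k.\<close>
  have pair: "(\<Sum>i\<in>UNIV. quad_jac (\<lambda>_ _. 0) ?c x i o' * \<xi> $ i)
      = 2 * (x $ o' * \<xi> $ o') + (\<Sum>a\<in>UNIV - {o'}. x $ a * \<xi> $ a)"
  proof -
    have "(\<Sum>i\<in>UNIV. quad_jac (\<lambda>_ _. 0) ?c x i o' * \<xi> $ i)
        = (\<Sum>i\<in>UNIV. (if i = o' then x $ o' * \<xi> $ o' else 0)) + (\<Sum>i\<in>UNIV. x $ i * \<xi> $ i)"
      unfolding sum.distrib[symmetric] M by (intro sum.cong) (auto simp: algebra_simps)
    also have "(\<Sum>i\<in>UNIV. x $ i * \<xi> $ i) = x $ o' * \<xi> $ o' + (\<Sum>a\<in>UNIV - {o'}. x $ a * \<xi> $ a)"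
      by (subst sum.remove[of _ o']) auto
    finally show ?thesis by simp
  qed
  define S K where "S = (\<Sum>a\<in>UNIV - {o'}. x $ a * \<xi> $ a)" and "K = real k * \<xi> $ o' ^ (k - 1)"
  have vf: "(\<Sum>i\<in>UNIV. quad_vf (\<lambda>_. 0) (\<lambda>_ _. 0) ?c x i * partial i (\<lambda>x. x $ o' ^ n) x) = real n * x $ o' ^ Suc n"
    unfolding V partial_nth_power by (cases n) (simp_all add: if_distrib[of "\<lambda>u. _ * u"] cong: if_cong)
  have jac: "(\<Sum>j\<in>UNIV. (\<Sum>i\<in>UNIV. quad_jac (\<lambda>_ _. 0) ?c x i j * \<xi> $ i) * partial j (\<lambda>\<xi>. \<xi> $ o' ^ k) \<xi>)
      = (2 * (x $ o' * \<xi> $ o') + S) * K"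
    unfolding partial_nth_power pair[symmetric] S_def K_def
    by (simp add: if_distrib[of "\<lambda>u. _ * u"] cong: if_cong)
  have K: "\<xi> $ o' * K = real k * \<xi> $ o' ^ k"
    unfolding K_def by (cases k) auto
  have "lie_symb d (quad_field (\<lambda>_. 0) (\<lambda>_ _. 0) ?c) (\<lambda>x \<xi>. x $ o' ^ n * \<xi> $ o' ^ k) x \<xi>
      = real n * x $ o' ^ Suc n * \<xi> $ o' ^ k - x $ o' ^ n * ((2 * (x $ o' * \<xi> $ o') + S) * K)
      + d * ((real CARD('m) + 1) * x $ o') * (x $ o' ^ n * \<xi> $ o' ^ k)"
    using product_symbol_lie[OF Cinf_power[OF Cinf_nth] Cinf_power[OF Cinf_nth]]
    unfolding T[symmetric] vf[symmetric] jac[symmetric] by blast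
  also have "\<dots> = real n * x $ o' ^ Suc n * \<xi> $ o' ^ k - 2 * x $ o' ^ Suc n * (\<xi> $ o' * K) - x $ o' ^ n * S * K
      + d * ((real CARD('m) + 1) * x $ o') * (x $ o' ^ n * \<xi> $ o' ^ k)"
    by (simp add: algebra_simps)
  also have "x $ o' ^ n * S * K = (\<Sum>a\<in>UNIV - {o'}. real k * (x $ a * x $ o' ^ (j - 1) * (\<xi> $ a * \<xi> $ o' ^ (k - 1))))"
    by (simp add: S_def K_def n sum_distrib_left sum_distrib_right mult_ac)
  finally show ?thesis
    unfolding K by (simp add: n algebra_simps)
qed

text \<open>The vector field \<open>x\<^sub>b \<partial>\<^sub>a\<close>.\<close>

definition shear_field :: "'m \<Rightarrow> 'm \<Rightarrow> real^'m \<Rightarrow> real^'m"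
  where "shear_field a b = quad_field (\<lambda>_. 0) (\<lambda>i j. if i = a \<and> j = b then 1 else 0) (\<lambda>_. 0)"

text \<open>Off the diagonal the field is divergence free, so no density term appears.\<close>

lemma shear_field_lie:
  fixes g p :: "real^'m \<Rightarrow> real"
  assumes g: "g \<in> Cinf" and p: "p \<in> Cinf" and ab: "a \<noteq> b"
  shows "lie_symb d (shear_field a b) (\<lambda>x \<xi>. g x * p \<xi>)
    = (\<lambda>x \<xi>. x $ b * partial a g x * p \<xi> - g x * (\<xi> $ a * partial b p \<xi>))"
proof (intro ext)
  fix x \<xi> :: "real^'m"
  let ?B = "\<lambda>i j. if i = a \<and> j = b then 1 else 0 :: real"
  have V: "quad_vf (\<lambda>_. 0) ?B (\<lambda>_. 0) x i = (if i = a then x $ b else 0)" for i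
    by (cases "i = a") (simp_all add: quad_vf_def if_distrib[of "\<lambda>u. u * _"] cong: if_cong)
  have M: "(\<Sum>i\<in>UNIV. quad_jac ?B (\<lambda>_. 0) x i j * \<xi> $ i) = (if j = b then \<xi> $ a else 0)" for j
    by (cases "j = b") (simp_all add: quad_jac_def if_distrib[of "\<lambda>u. u * _"] cong: if_cong)
  have T: "quad_trace ?B (\<lambda>_. 0) x = 0"
    using ab by (auto simp: quad_trace_def intro!: sum.neutral)
  show "lie_symb d (shear_field a b) (\<lambda>x \<xi>. g x * p \<xi>) x \<xi>
      = x $ b * partial a g x * p \<xi> - g x * (\<xi> $ a * partial b p \<xi>)"
    unfolding shear_field_def product_symbol_lie[OF g p] V M T
    by (simp add: if_distrib[of "\<lambda>u. u * _"] cong: if_cong)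
qed

text \<open>The operand exponent is dictated by dilations: the symbol with exponents j and k has
  weight j - k, which the degree k - j of the operand compensates.\<close>

lemma equivariant_lift_recursion:
  fixes s :: "(real^'m \<Rightarrow> real^'m \<Rightarrow> real) \<Rightarrow> (real^'m \<Rightarrow> real) \<Rightarrow> real^'m \<Rightarrow> real" and o' :: 'm
  assumes hom: "module_hom_on sl_proj (symbol_module k d) (diff_op_module k l u) s"
    and j: "1 \<le> j" "j \<le> k"
  shows "(d * (real CARD('m) + 1) - (real CARD('m) + 2 * real k - real j))
      * s (\<lambda>x \<xi>. x $ o' ^ j * \<xi> $ o' ^ k) (\<lambda>x. x $ o' ^ (k - j)) 0
    = - ((real k - real j + l * (real CARD('m) + 1))
      * s (\<lambda>x \<xi>. x $ o' ^ (j - 1) * \<xi> $ o' ^ k) (\<lambda>x. x $ o' ^ (k - (j - 1))) 0)"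
proof -
  let ?S = "mcarrier (symbol_module k d) :: (real^'m \<Rightarrow> real^'m \<Rightarrow> real) set"
  define f where "f = (\<lambda>x::real^'m. x $ o' ^ (k - j))"
  have f: "f \<in> Cinf" unfolding f_def by (intro Cinf_power Cinf_nth)
  define e where "e i = (\<lambda>x \<xi> :: real^'m. x $ o' ^ i * \<xi> $ o' ^ k)" for i
  have e: "e i \<in> ?S" for i
    using monomial_symbol[of "axis_mi o' k" k "\<lambda>x. x $ o' ^ i"]
    by (auto simp: e_def intro!: symbol_carrierI Cinf_power)
  have carrier: "s P \<in> mcarrier (diff_op_module k l u)" if "P \<in> ?S" for P
    using hom that unfolding module_hom_on_def by blast
  \<comment> \<open>Linearity in the operand holds because the values of \<open>s\<close> are
    differential operators, however \<open>s\<close> depends on the symbol.\<close>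
  have scale_arg: "s P (\<lambda>x. r * g x) 0 = r * s P g 0" if P: "P \<in> ?S" and g: "g \<in> Cinf" for P g r
  proof -
    obtain a where "s P = diff_op k a" using carrier[OF P] by (rule diff_op_carrier_cases)
    with g show ?thesis by (simp add: diff_op_eq fam_op_cmult Cinf_mult)
  qed
  have add: "s (\<lambda>x \<xi>. P x \<xi> + Q x \<xi>) f 0 = s P f 0 + s Q f 0" if "P \<in> ?S" "Q \<in> ?S" for P Q
  proof -
    have "s (madd (symbol_module k d) P Q) = madd (diff_op_module k l u) (s P) (s Q)"
      using hom that unfolding module_hom_on_def by blast
    then show ?thesis using f by (simp add: symbol_module_def diff_op_module_def)
  qed
  have scale: "s (\<lambda>x \<xi>. r * P x \<xi>) f 0 = r * s P f 0" if "P \<in> ?S" for P r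
  proof -
    have "s (mscale (symbol_module k d) r P) = mscale (diff_op_module k l u) r (s P)"
      using hom that unfolding module_hom_on_def by blast
    then show ?thesis using f by (simp add: symbol_module_def diff_op_module_def)
  qed
  have scale_S: "(\<lambda>x \<xi>. r * P x \<xi>) \<in> ?S" if P: "P \<in> ?S" for P r
  proof -
    obtain a where a: "\<And>\<alpha>. a \<alpha> \<in> Cinf" "P = symb_of k a" using P by (rule symbol_carrier_cases) blast
    have "mscale (symbol_module k d) r P \<in> ?S"
      unfolding a(2) symbol_mscale by (intro symbol_carrierI Cinf_mult Cinf_const a(1))
    then show ?thesis by (simp add: symbol_module_def)
  qed
  have add_S: "(\<lambda>x \<xi>. P x \<xi> + Q x \<xi>) \<in> ?S" if P: "P \<in> ?S" and Q: "Q \<in> ?S" for P Q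
  proof -
    obtain a where a: "\<And>\<alpha>. a \<alpha> \<in> Cinf" "P = symb_of k a" using P by (rule symbol_carrier_cases) blast
    obtain b where b: "\<And>\<alpha>. b \<alpha> \<in> Cinf" "Q = symb_of k b" using Q by (rule symbol_carrier_cases) blast
    have "madd (symbol_module k d) P Q \<in> ?S"
      unfolding a(2) b(2) symbol_madd by (intro symbol_carrierI Cinf_add a(1) b(1))
    then show ?thesis by (simp add: symbol_module_def)
  qed
  have zero_S: "(\<lambda>x \<xi>. 0) \<in> ?S" using scale_S[OF e, of 0 0] by simp
  have lie_S: "lie_symb d (quad_field A B c) P \<in> ?S" if P: "P \<in> ?S" for A B c P
  proof -
    obtain a where a: "\<And>\<alpha>. a \<alpha> \<in> Cinf" "P = symb_of k a" using P by (rule symbol_carrier_cases) blast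
    show ?thesis
      unfolding a(2) lie_symb_symb_of[OF a(1)] by (intro symbol_carrierI fam_lie_Cinf a(1))
  qed
  have sum: "(\<lambda>x \<xi>. \<Sum>i\<in>I. P i x \<xi>) \<in> ?S \<and> s (\<lambda>x \<xi>. \<Sum>i\<in>I. P i x \<xi>) f 0 = (\<Sum>i\<in>I. s (P i) f 0)"
    if "finite I" "\<And>i. i \<in> I \<Longrightarrow> P i \<in> ?S" for I :: "'m set" and P
    using that
  proof (induction I rule: finite_induct)
    case empty
    show ?case using zero_S scale[OF zero_S, of 0] by simp
  next
    case (insert i I)
    then show ?case by (simp add: add add_S)
  qed
  \<comment> \<open>Since the field and its divergence vanish at the origin, the Lie derivative on
    the target densities contributes nothing there.\<close>
  have equi: "s (lie_symb d (quad_field A B c) P) f 0 = - s P (lie_dens l (quad_field A B c) f) 0"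
    if P: "P \<in> ?S" and A: "\<And>i. quad_vf A B c 0 i = 0" and t: "quad_trace B c 0 = 0" for A B c P
  proof -
    have "quad_field A B c \<in> sl_proj" unfolding sl_proj_iff by blast
    then have "s (mact (symbol_module k d) (quad_field A B c) P) = mact (diff_op_module k l u) (quad_field A B c) (s P)"
      using hom P unfolding module_hom_on_def by blast
    then have "s (lie_symb d (quad_field A B c) P) f 0
        = lie_dens u (quad_field A B c) (s P f) 0 - s P (lie_dens l (quad_field A B c) f) 0"
      using f by (simp add: symbol_module_def diff_op_module_def)
    then show ?thesis by (simp add: lie_dens_quad_field A t)
  qed
  let ?c = "\<lambda>i. if i = o' then 1 else 0 :: real"
  let ?X = "quad_field (\<lambda>_. 0) (\<lambda>_ _. 0) ?c"
  define Q where "Q a = lie_symb d (shear_field a o') (lie_symb d (shear_field o' a) (e j))" for a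
  have Q_S: "Q a \<in> ?S" for a
    unfolding Q_def shear_field_def by (intro lie_S e)
  have Q: "Q a x \<xi> = real j * (x $ o' ^ j * \<xi> $ o' ^ k)
      - real j * (real k * (x $ a * x $ o' ^ (j - 1) * (\<xi> $ a * \<xi> $ o' ^ (k - 1))))"
    if a: "a \<noteq> o'" for a x \<xi>
  proof -
    have p0: "partial a (\<lambda>\<xi>. \<xi> $ o' ^ k) = (\<lambda>_. 0)" "partial o' (\<lambda>\<xi>. \<xi> $ o' ^ k) = (\<lambda>\<xi>. real k * \<xi> $ o' ^ (k - 1))"
      using a by (auto simp: partial_nth_power fun_eq_iff)
    have g0: "partial o' (\<lambda>x. x $ o' ^ j) = (\<lambda>x. real j * x $ o' ^ (j - 1))"
      by (auto simp: partial_nth_power fun_eq_iff)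
    \<comment> \<open>The other term of \<open>shear_field_lie\<close> drops out because the power
      of \<xi>_o' does not involve \<xi>_a.\<close>
    have 1: "lie_symb d (shear_field o' a) (e j) = (\<lambda>x \<xi>. (x $ a * (real j * x $ o' ^ (j - 1))) * \<xi> $ o' ^ k)"
      unfolding e_def
      by (subst shear_field_lie) (use a in \<open>auto simp: p0 g0 Cinf_power\<close>)
    have g: "(\<lambda>x. x $ a * (real j * x $ o' ^ (j - 1))) \<in> Cinf"
      by (intro Cinf_mult Cinf_nth Cinf_const Cinf_power)
    have "(\<lambda>y. real j * y $ o' ^ (j - 1)) differentiable (at x)"
      by (intro Cinf_differentiable Cinf_mult Cinf_const Cinf_power Cinf_nth)
    moreover have "partial a (\<lambda>y. real j * y $ o' ^ (j - 1)) x = 0"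
      using a by (simp add: partial_cmult partial_nth_power Cinf_differentiable Cinf_power)
    ultimately have dg: "partial a (\<lambda>x. x $ a * (real j * x $ o' ^ (j - 1))) x = real j * x $ o' ^ (j - 1)"
      by (simp add: partial_mult)
    have pw: "x $ o' * x $ o' ^ (j - 1) = x $ o' ^ j" using j by (cases j) auto
    have "Q a x \<xi> = x $ o' * (real j * x $ o' ^ (j - 1)) * \<xi> $ o' ^ k
        - (x $ a * (real j * x $ o' ^ (j - 1))) * (\<xi> $ a * (real k * \<xi> $ o' ^ (k - 1)))"
      unfolding Q_def 1 shear_field_lie[OF g Cinf_power[OF Cinf_nth] a] dg p0 ..
    then show ?thesis
      unfolding pw[symmetric] by (simp add: algebra_simps)
  qed
  have Q0: "s (Q a) f 0 = 0" if a: "a \<noteq> o'" for a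
  proof -
    let ?B = "\<lambda>i j. if i = a \<and> j = o' then 1 else 0 :: real"
    have V: "quad_vf (\<lambda>_. 0) ?B (\<lambda>_. 0) x i = (if i = a then x $ o' else 0)" for i x
      by (cases "i = a") (simp_all add: quad_vf_def if_distrib[of "\<lambda>u. u * _"] cong: if_cong)
    have T: "quad_trace ?B (\<lambda>_. 0) x = 0" for x
      using a by (auto simp: quad_trace_def intro!: sum.neutral)
    have S: "lie_symb d (shear_field o' a) (e j) \<in> ?S"
      unfolding shear_field_def by (intro lie_S e)
    have "s (Q a) f 0 = - s (lie_symb d (shear_field o' a) (e j)) (lie_dens l (shear_field a o') f) 0"
      unfolding Q_def shear_field_def[of a] by (rule equi[OF S]) (simp_all add: V T)
    \<comment> \<open>The operand depends on x_o' alone, so the field kills it; writing zero as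
      \<open>0 * f x\<close> makes \<open>scale_arg\<close> applicable.\<close>
    also have "lie_dens l (shear_field a o') f = (\<lambda>x. 0 * f x)"
      using a unfolding shear_field_def lie_dens_quad_field V T f_def partial_nth_power
      by (auto simp: fun_eq_iff intro!: sum.neutral)
    finally show ?thesis using scale_arg[OF S f, of 0] by simp
  qed
  let ?\<kappa> = "d * (real CARD('m) + 1) - (real CARD('m) + 2 * real k - real j)"
  have jpos: "real j \<noteq> 0" using j by simp
  \<comment> \<open>Each of the m - 1 double shears, divided by j, carries one copy of
    \<open>e j\<close> besides the mixed term it removes. Subtracting these copies changes j - 1 - 2
    k into j - 2 k - m.\<close>
  have decomp: "lie_symb d ?X (e (j - 1)) = (\<lambda>x \<xi>. ?\<kappa> * e j x \<xi> + (\<Sum>a\<in>UNIV - {o'}. (1 / real j) * Q a x \<xi>))"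
  proof (intro ext)
    fix x \<xi> :: "real^'m"
    have "(\<Sum>a\<in>UNIV - {o'}. (1 / real j) * Q a x \<xi>)
        = (\<Sum>a\<in>UNIV - {o'}. x $ o' ^ j * \<xi> $ o' ^ k
          - real k * (x $ a * x $ o' ^ (j - 1) * (\<xi> $ a * \<xi> $ o' ^ (k - 1))))"
      using jpos by (intro sum.cong refl) (simp add: Q field_simps)
    also have "\<dots> = (real CARD('m) - 1) * (x $ o' ^ j * \<xi> $ o' ^ k)
        - (\<Sum>a\<in>UNIV - {o'}. real k * (x $ a * x $ o' ^ (j - 1) * (\<xi> $ a * \<xi> $ o' ^ (k - 1))))"
      by (simp add: sum_subtractf card_Diff_singleton of_nat_diff Suc_leI)
    finally show "lie_symb d ?X (e (j - 1)) x \<xi> = ?\<kappa> * e j x \<xi> + (\<Sum>a\<in>UNIV - {o'}. (1 / real j) * Q a x \<xi>)"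
      unfolding e_def lie_special_monomial[OF j(1)] by (simp add: algebra_simps)
  qed
  have lhs: "s (lie_symb d ?X (e (j - 1))) f 0 = ?\<kappa> * s (e j) f 0"
  proof -
    have sm: "(\<lambda>x \<xi>. \<Sum>a\<in>UNIV - {o'}. (1 / real j) * Q a x \<xi>) \<in> ?S"
      "s (\<lambda>x \<xi>. \<Sum>a\<in>UNIV - {o'}. (1 / real j) * Q a x \<xi>) f 0 = (\<Sum>a\<in>UNIV - {o'}. s (\<lambda>x \<xi>. (1 / real j) * Q a x \<xi>) f 0)"
      using sum[of "UNIV - {o'}" "\<lambda>a x \<xi>. (1 / real j) * Q a x \<xi>", OF finite scale_S[OF Q_S]]
      by blast+
    have "(\<Sum>a\<in>UNIV - {o'}. s (\<lambda>x \<xi>. (1 / real j) * Q a x \<xi>) f 0) = 0"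
      unfolding scale[OF Q_S] by (rule sum.neutral) (use Q0 in auto)
    then show ?thesis
      unfolding decomp add[OF scale_S[OF e] sm(1)] scale[OF e] sm(2) by simp
  qed
  have rhs: "s (lie_symb d ?X (e (j - 1))) f 0
      = - ((real k - real j + l * (real CARD('m) + 1)) * s (e (j - 1)) (\<lambda>x. x $ o' ^ (k - (j - 1))) 0)"
  proof -
    have lin: "(\<Sum>l\<in>UNIV. ?c l * x $ l) = x $ o'" for x :: "real^'m"
      by (simp add: if_distrib[of "\<lambda>u. u * _"] cong: if_cong)
    have V: "quad_vf (\<lambda>_. 0) (\<lambda>_ _. 0) ?c x i = x $ o' * x $ i" for x i
      by (simp add: quad_vf_def lin)
    have T: "quad_trace (\<lambda>_ _. 0) ?c x = (real CARD('m) + 1) * x $ o'" for x :: "real^'m"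
      by (simp add: quad_trace_def lin)
    define n where "n = k - j"
    have n: "k - (j - 1) = Suc n" "real k - real j = real n" using j by (auto simp: n_def)
    \<comment> \<open>The field raises the operand to degree k - (j - 1), the one that goes with
      \<open>e (j - 1)\<close>.\<close>
    have "lie_dens l ?X f = (\<lambda>x. (real n + l * (real CARD('m) + 1)) * x $ o' ^ Suc n)"
    proof
      fix x :: "real^'m"
      have "(\<Sum>i\<in>UNIV. x $ o' * x $ i * partial i f x) = real n * x $ o' ^ Suc n"
        unfolding f_def n_def[symmetric] partial_nth_power
        by (cases n) (simp_all add: if_distrib[of "\<lambda>u. _ * u"] cong: if_cong)
      then show "lie_dens l ?X f x = (real n + l * (real CARD('m) + 1)) * x $ o' ^ Suc n"
        unfolding lie_dens_quad_field V T by (simp add: f_def n_def[symmetric] algebra_simps)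
    qed
    moreover have "s (lie_symb d ?X (e (j - 1))) f 0 = - s (e (j - 1)) (lie_dens l ?X f) 0"
      by (rule equi[OF e]) (simp_all add: V T)
    ultimately show ?thesis
      unfolding n by (simp add: scale_arg[OF e Cinf_power[OF Cinf_nth]] del: power_Suc)
  qed
  show ?thesis
    using lhs rhs unfolding e_def f_def by simp
qed

text \<open>The value is k!: the section property makes the relevant top coefficient 1, and all
  other derivatives of the operand up to order k vanish at 0. The exponents \<open>0\<close> and
  \<open>k - 0\<close> keep the shape of the recursion at j = 0.\<close>

lemma lift_leading_nonzero:
  fixes s :: "(real^'m \<Rightarrow> real^'m \<Rightarrow> real) \<Rightarrow> (real^'m \<Rightarrow> real) \<Rightarrow> real^'m \<Rightarrow> real" and o' :: 'm
  assumes hom: "module_hom_on sl_proj (symbol_module k d) (diff_op_module k l u) s"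
    and sec: "\<And>P. P \<in> mcarrier (symbol_module k d) \<Longrightarrow> principal_symbol k (s P) = P"
  shows "s (\<lambda>x \<xi>. x $ o' ^ 0 * \<xi> $ o' ^ k) (\<lambda>x. x $ o' ^ (k - 0)) 0 \<noteq> 0"
proof -
  let ?\<beta> = "axis_mi o' k"
  define b where "b = (\<lambda>\<alpha>. if \<alpha> = ?\<beta> then (\<lambda>x::real^'m. 1::real) else (\<lambda>_. 0))"
  have P: "(\<lambda>x \<xi>. x $ o' ^ 0 * \<xi> $ o' ^ k) = symb_of k b"
    using monomial_symbol[of ?\<beta> k "\<lambda>x. 1"] by (simp add: b_def)
  have S: "symb_of k b \<in> mcarrier (symbol_module k d)"
    by (rule symbol_carrierI) (simp add: b_def)
  then have "s (symb_of k b) \<in> mcarrier (diff_op_module k l u)"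
    using hom unfolding module_hom_on_def by blast
  then obtain a where a: "\<And>\<alpha>. a \<alpha> \<in> Cinf" "s (symb_of k b) = diff_op k a"
    by (rule diff_op_carrier_cases) blast
  have "symb_of k a = symb_of k b"
    using sec[OF S] unfolding a(2) principal_symbol_diff_op[OF a(1)] .
  then have "symb_coeff k (symb_of k a) ?\<beta> = symb_coeff k (symb_of k b) ?\<beta>" by simp
  then have ab: "a ?\<beta> = (\<lambda>_. 1)" by (simp add: symb_coeff_symb_of b_def)
  have "fam_op k a (\<lambda>y. mi_power (y - 0) ?\<beta>) 0 = a ?\<beta> 0 * mi_fact ?\<beta>"
    by (rule fam_op_mi_power) simp
  then have "s (symb_of k b) (\<lambda>x. x $ o' ^ k) 0 = mi_fact ?\<beta>"
    by (simp add: a(2) ab diff_op_eq Cinf_power)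
  then show ?thesis unfolding P by simp
qed

section \<open>Comparison of the recursion with the stated condition\<close>

theorem theorem8p5:
  fixes k :: nat and lam mu \<delta> :: real
  assumes "k \<ge> 1" and "\<delta> = mu - lam"
  shows "split_short_exact (sl_proj :: (real^'m \<Rightarrow> real^'m) set)
      (diff_op_module (k - 1) lam mu) (\<lambda>A. A)
      (diff_op_module k lam mu) (principal_symbol k)
      (symbol_module k \<delta>)
    \<longleftrightarrow>
      \<delta> \<notin> (\<lambda>j. (real CARD('m) + real j) / (real CARD('m) + 1)) ` {k..2 * k - 1}
    \<or> (\<exists>n\<in>{1..k}. \<exists>i\<in>{1..n}.
          \<delta> = (real CARD('m) + 2 * real k - real n) / (real CARD('m) + 1)
        \<and> lam = (real i - real k) / (real CARD('m) + 1))"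
proof -
  define M where "M = real CARD('m)"
  have M: "M + 1 > 0" by (simp add: M_def)
  define p where "p i = real k - real i + lam * (M + 1)" for i
  define q where "q n = real n * (\<delta> * (M + 1) - (M + 2 * real k - real n))" for n
  have p0: "p i = 0 \<longleftrightarrow> lam = (real i - real k) / (M + 1)" for i
    using M unfolding p_def by (simp add: eq_divide_eq) argo
  have q0: "q n = 0 \<longleftrightarrow> \<delta> = (M + 2 * real k - real n) / (M + 1)" if "1 \<le> n" for n
    using M that unfolding q_def by (simp add: eq_divide_eq) 
  \<comment> \<open>The substitution j = 2 k - n exchanges the ranges k..2k-1 and 1..k.\<close>
  have resonant: "\<delta> \<in> (\<lambda>j. (M + real j) / (M + 1)) ` {k..2 * k - 1} \<longleftrightarrow> (\<exists>n\<in>{1..k}. q n = 0)"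
  proof
    assume "\<delta> \<in> (\<lambda>j. (M + real j) / (M + 1)) ` {k..2 * k - 1}"
    then obtain j where j: "k \<le> j" "j \<le> 2 * k - 1" "\<delta> = (M + real j) / (M + 1)" by auto
    have "q (2 * k - j) = 0"
      using j assms(1) by (subst q0) (auto simp: of_nat_diff)
    with j assms(1) show "\<exists>n\<in>{1..k}. q n = 0" by (intro bexI[of _ "2 * k - j"]) auto
  next
    assume "\<exists>n\<in>{1..k}. q n = 0"
    then obtain n where n: "1 \<le> n" "n \<le> k" "q n = 0" by auto
    then have "\<delta> = (M + real (2 * k - n)) / (M + 1)"
      using q0[OF n(1)] by (simp add: of_nat_diff)
    then show "\<delta> \<in> (\<lambda>j. (M + real j) / (M + 1)) ` {k..2 * k - 1}"
      using n by (intro image_eqI[of _ _ "2 * k - n"]) auto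
  qed
  \<comment> \<open>As \<delta> determines the resonant index, "no resonance, or a compensated one"
    says that every resonance is compensated.\<close>
  have unique: "n = n'" if "n \<in> {1..k}" "n' \<in> {1..k}" "q n = 0" "q n' = 0" for n n'
    using that by (simp add: q_def)
  have exceptional: "(\<exists>n\<in>{1..k}. \<exists>i\<in>{1..n}. \<delta> = (M + 2 * real k - real n) / (M + 1)
        \<and> lam = (real i - real k) / (M + 1)) \<longleftrightarrow> (\<exists>n\<in>{1..k}. q n = 0 \<and> (\<exists>i\<in>{1..n}. p i = 0))"
    unfolding p0 by (rule bex_cong[OF refl]) (simp add: q0)
  have rhs: "\<delta> \<notin> (\<lambda>j. (real CARD('m) + real j) / (real CARD('m) + 1)) ` {k..2 * k - 1}
    \<or> (\<exists>n\<in>{1..k}. \<exists>i\<in>{1..n}.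
          \<delta> = (real CARD('m) + 2 * real k - real n) / (real CARD('m) + 1)
        \<and> lam = (real i - real k) / (real CARD('m) + 1))
    \<longleftrightarrow> (\<forall>n\<in>{1..k}. q n = 0 \<longrightarrow> (\<exists>i\<in>{1..n}. p i = 0))"
    unfolding M_def[symmetric] resonant exceptional using unique by blast
  show ?thesis
    unfolding rhs
  proof
    assume "\<forall>n\<in>{1..k}. q n = 0 \<longrightarrow> (\<exists>i\<in>{1..n}. p i = 0)"
    then obtain w where "w 0 = 1" "\<And>j. 1 \<le> j \<Longrightarrow> j \<le> k \<Longrightarrow> w j * q j = - (p j * w (j - 1))"
      using recursion_solvable[of k q p] by auto
    then show "split_short_exact (sl_proj :: (real^'m \<Rightarrow> real^'m) set)
      (diff_op_module (k - 1) lam mu) (\<lambda>A. A)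
      (diff_op_module k lam mu) (principal_symbol k)
      (symbol_module k \<delta>)"
      using assms by (intro split_if_recursion[of k \<delta> mu lam w]) (simp_all add: p_def q_def M_def mult.assoc)
  next
    assume "split_short_exact (sl_proj :: (real^'m \<Rightarrow> real^'m) set)
      (diff_op_module (k - 1) lam mu) (\<lambda>A. A)
      (diff_op_module k lam mu) (principal_symbol k)
      (symbol_module k \<delta>)"
    then obtain s :: "(real^'m \<Rightarrow> real^'m \<Rightarrow> real) \<Rightarrow> (real^'m \<Rightarrow> real) \<Rightarrow> real^'m \<Rightarrow> real" where
      hom: "module_hom_on sl_proj (symbol_module k \<delta>) (diff_op_module k lam mu) s"
      and sec: "\<And>P. P \<in> mcarrier (symbol_module k \<delta>) \<Longrightarrow> principal_symbol k (s P) = P"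
      unfolding split_short_exact_def by blast
    obtain o' :: 'm where True by blast
    define b where "b j = s (\<lambda>x \<xi>. x $ o' ^ j * \<xi> $ o' ^ k) (\<lambda>x. x $ o' ^ (k - j)) 0" for j
    have rec: "q j * b j = - (real j * (p j * b (j - 1)))" if "1 \<le> j" "j \<le> k" for j
      using equivariant_lift_recursion[OF hom that, of o']
      unfolding b_def q_def p_def M_def by (simp only: mult.assoc mult_minus_right)
    show "\<forall>n\<in>{1..k}. q n = 0 \<longrightarrow> (\<exists>i\<in>{1..n}. p i = 0)"
    proof (intro ballI impI, rule ccontr)
      fix n
      assume n: "n \<in> {1..k}" "q n = 0" and np: "\<not> (\<exists>i\<in>{1..n}. p i = 0)"
      \<comment> \<open>Below n the right side of \<open>rec\<close> is nonzero, hence so is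
        \<open>q j * b j\<close>, and with it b_j. At n the left side vanishes while the right side
        still does not.\<close>
      have "b j \<noteq> 0" if "j < n" for j
        using that
      proof (induction j)
        case 0
        show ?case unfolding b_def by (rule lift_leading_nonzero[OF hom sec])
      next
        case (Suc j)
        with np have "real (Suc j) * (p (Suc j) * b j) \<noteq> 0" by auto
        with rec[of "Suc j"] Suc.prems n(1) show ?case by auto
      qed
      then have "real n * (p n * b (n - 1)) \<noteq> 0" using n(1) np by auto
      with rec[of n] n show False by auto
    qed
  qed
qed

end
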